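(* Let $m$ be a non-negative integer and let $n\geq 2$. Let $\mathbf{F}_m$ and $\mathbf{F}_n$ be free groups of rank $m$ and $n$, respectively, each equipped with the bi-invariant word metric associated with a finite generating set. Then a homomorphism $\varphi\colon \mathbf{F}_m\to \mathbf{F}_n$ is a quasi-isometry if and only if it is an isomorphism.
   Context: Bi-invariant word metric: Let $G$ be a group generated by a set $S\subseteq G$ and let $\overline{S}=\{gsg^{-1} : s^{\pm 1}\in S,\ g\in G\}$ be the closure of $S$ under inverses and conjugation. For $g\in G$ let $\|g\|_S$ be the least $k\ge 0$ such that $g=s_1\cdots s_k$ with all $s_i\in\overline{S}$ (so $\|1\|_S=0$). The bi-invariant word metric on $G$ associated with $S$ is $d_S(x,y)=\|x^{-1}y\|_S=\|xy^{-1}\|_S$. Quasi-isometry: a map $\varphi\colon (X_1,d_1)\to (X_2,d_2)$ between metric spaces is a quasi-isometry if (1) there exist $C>0$ and $D\geq 0$ such that $\frac{1}{C}d_1(x,y)-D\leq d_2(\varphi(x),\varphi(y))\leq C d_1(x,y)+D$ for all $x,y\in X_1$; and (2) there exists $B\geq 0$ such that for every $y\in X_2$ there exists $x\in X_1$ with $d_2(\varphi(x),y)\leq B$. *)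

theory Defs
  imports "HOL-Analysis.Abstract_Metric_Spaces" "HOL-Algebra.Generated_Groups"
begin

definition list_prod :: "('a, 'b) monoid_scheme \<Rightarrow> 'a list \<Rightarrow> 'a" where
  "list_prod G xs = foldr (\<lambda>x y. x \<otimes>\<^bsub>G\<^esub> y) xs \<one>\<^bsub>G\<^esub>"

text \<open>A letter \<open>(x, True)\<close> stands for \<open>x\<close> and \<open>(x, False)\<close> for its formal inverse.\<close>

definition eval_letter :: "('a, 'b) monoid_scheme \<Rightarrow> 'a \<times> bool \<Rightarrow> 'a" where
  "eval_letter G l = (if snd l then fst l else inv\<^bsub>G\<^esub> (fst l))"

definition eval_word :: "('a, 'b) monoid_scheme \<Rightarrow> ('a \<times> bool) list \<Rightarrow> 'a" where
  "eval_word G w = list_prod G (map (eval_letter G) w)"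

definition reduced_words :: "'a set \<Rightarrow> ('a \<times> bool) list set" where
  "reduced_words X = {w. fst ` set w \<subseteq> X \<and>
     (\<forall>i. Suc i < length w \<longrightarrow>
        \<not> (fst (w ! i) = fst (w ! Suc i) \<and> snd (w ! i) \<noteq> snd (w ! Suc i)))}"

text \<open>\<open>X\<close> is a free basis of \<open>G\<close> when every element of \<open>G\<close> is the value of exactly one
  reduced word in \<open>X\<close> and formal inverses, i.e. when evaluation identifies \<open>G\<close> with the
  group of reduced words on \<open>X\<close>.\<close>

definition free_basis :: "('a, 'b) monoid_scheme \<Rightarrow> 'a set \<Rightarrow> bool" where
  "free_basis G X \<longleftrightarrow> X \<subseteq> carrier G \<and> bij_betw (eval_word G) (reduced_words X) (carrier G)"

definition free_group_of_rank :: "('a, 'b) monoid_scheme \<Rightarrow> nat \<Rightarrow> bool" where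
  "free_group_of_rank G n \<longleftrightarrow>
     group G \<and> (\<exists>X. free_basis G X \<and> finite X \<and> card X = n)"

definition generating_set :: "('a, 'b) monoid_scheme \<Rightarrow> 'a set \<Rightarrow> bool" where
  "generating_set G S \<longleftrightarrow> S \<subseteq> carrier G \<and> generate G S = carrier G"

definition conj_closure :: "('a, 'b) monoid_scheme \<Rightarrow> 'a set \<Rightarrow> 'a set" where
  "conj_closure G S = {g \<otimes>\<^bsub>G\<^esub> s \<otimes>\<^bsub>G\<^esub> inv\<^bsub>G\<^esub> g | g s.
     g \<in> carrier G \<and> s \<in> carrier G \<and> (s \<in> S \<or> inv\<^bsub>G\<^esub> s \<in> S)}"

definition biinv_norm :: "('a, 'b) monoid_scheme \<Rightarrow> 'a set \<Rightarrow> 'a \<Rightarrow> nat" where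
  "biinv_norm G S g =
     (LEAST k. \<exists>xs. length xs = k \<and> set xs \<subseteq> conj_closure G S \<and> g = list_prod G xs)"

definition biinv_dist :: "('a, 'b) monoid_scheme \<Rightarrow> 'a set \<Rightarrow> 'a \<Rightarrow> 'a \<Rightarrow> real" where
  "biinv_dist G S x y = real (biinv_norm G S (inv\<^bsub>G\<^esub> x \<otimes>\<^bsub>G\<^esub> y))"

definition quasi_isometry ::
  "'a set \<Rightarrow> ('a \<Rightarrow> 'a \<Rightarrow> real) \<Rightarrow> 'b set \<Rightarrow> ('b \<Rightarrow> 'b \<Rightarrow> real) \<Rightarrow> ('a \<Rightarrow> 'b) \<Rightarrow> bool" where
  "quasi_isometry X1 d1 X2 d2 f \<longleftrightarrow>
     f \<in> X1 \<rightarrow> X2 \<and>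
     (\<exists>C D. C > 0 \<and> D \<ge> 0 \<and>
        (\<forall>x\<in>X1. \<forall>y\<in>X1.
           1 / C * d1 x y - D \<le> d2 (f x) (f y) \<and> d2 (f x) (f y) \<le> C * d1 x y + D)) \<and>
     (\<exists>B\<ge>0. \<forall>y\<in>X2. \<exists>x\<in>X1. d2 (f x) y \<le> B)"

text \<open>Restricted to the carrier, \<open>biinv_dist G S\<close> is a metric, and the two formulas for the distance agree.\<close>

context group
begin

lemma conj_closure_carrier: "conj_closure G S \<subseteq> carrier G"
  by (auto simp: conj_closure_def)

lemma list_prod_closed: "set xs \<subseteq> carrier G \<Longrightarrow> list_prod G xs \<in> carrier G"
  by (induction xs) (auto simp: list_prod_def)

lemma list_prod_append:
  "set xs \<subseteq> carrier G \<Longrightarrow> set ys \<subseteq> carrier G \<Longrightarrow>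
     list_prod G (xs @ ys) = list_prod G xs \<otimes> list_prod G ys"
proof (induction xs)
  case Nil
  then show ?case using list_prod_closed[of ys] by (simp add: list_prod_def)
next
  case (Cons x xs)
  then show ?case using list_prod_closed[of xs] list_prod_closed[of ys]
    by (auto simp: list_prod_def m_assoc)
qed

lemma conj_closure_inv:
  assumes "x \<in> conj_closure G S" shows "inv x \<in> conj_closure G S"
proof -
  obtain g s where gs: "x = g \<otimes> s \<otimes> inv g" "g \<in> carrier G" "s \<in> carrier G"
    "s \<in> S \<or> inv s \<in> S" using assms by (auto simp: conj_closure_def)
  then have "inv x = g \<otimes> inv s \<otimes> inv g" by (simp add: inv_mult_group m_assoc)
  with gs show ?thesis unfolding conj_closure_def
    by (intro CollectI exI[of _ g] exI[of _ "inv s"]) auto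
qed

lemma conj_closure_conj:
  assumes "x \<in> conj_closure G S" "h \<in> carrier G"
  shows "h \<otimes> x \<otimes> inv h \<in> conj_closure G S"
proof -
  obtain g s where gs: "x = g \<otimes> s \<otimes> inv g" "g \<in> carrier G" "s \<in> carrier G"
    "s \<in> S \<or> inv s \<in> S" using assms by (auto simp: conj_closure_def)
  then have "h \<otimes> x \<otimes> inv h = (h \<otimes> g) \<otimes> s \<otimes> inv (h \<otimes> g)"
    using assms(2) by (simp add: inv_mult_group m_assoc)
  with gs assms(2) show ?thesis unfolding conj_closure_def
    by (intro CollectI exI[of _ "h \<otimes> g"] exI[of _ s]) auto
qed

lemma list_prod_inv:
  "set xs \<subseteq> conj_closure G S \<Longrightarrow>
     \<exists>ys. length ys = length xs \<and> set ys \<subseteq> conj_closure G S \<and> inv (list_prod G xs) = list_prod G ys"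
proof (induction xs)
  case Nil
  then show ?case by (simp add: list_prod_def)
next
  case (Cons x xs)
  then obtain ys where ys: "length ys = length xs" "set ys \<subseteq> conj_closure G S"
    "inv (list_prod G xs) = list_prod G ys" by auto
  have c: "x \<in> carrier G" "set xs \<subseteq> carrier G" "set ys \<subseteq> carrier G" "inv x \<in> conj_closure G S"
    using Cons.prems ys conj_closure_carrier[of S] conj_closure_inv by auto
  have "inv (list_prod G (x # xs)) = list_prod G ys \<otimes> inv x"
    using c list_prod_closed[of xs] ys(3) by (simp add: list_prod_def inv_mult_group)
  also have "\<dots> = list_prod G (ys @ [inv x])"
    using c by (simp add: list_prod_append) (simp add: list_prod_def)
  finally show ?case using ys c by (intro exI[of _ "ys @ [inv x]"]) auto
qed

lemma list_prod_conj:
  assumes "h \<in> carrier G"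
  shows "set xs \<subseteq> carrier G \<Longrightarrow>
    h \<otimes> list_prod G xs \<otimes> inv h = list_prod G (map (\<lambda>x. h \<otimes> x \<otimes> inv h) xs)"
proof (induction xs)
  case Nil
  then show ?case using assms by (simp add: list_prod_def)
next
  case (Cons x xs)
  have c: "x \<in> carrier G" "list_prod G xs \<in> carrier G"
    using Cons.prems list_prod_closed[of xs] by auto
  have "h \<otimes> (x \<otimes> list_prod G xs) \<otimes> inv h = (h \<otimes> x \<otimes> inv h) \<otimes> (h \<otimes> list_prod G xs \<otimes> inv h)"
    using c assms by (simp add: m_assoc inv_solve_left' flip: m_assoc[of "inv h" h])
  then show ?case using Cons by (simp add: list_prod_def)
qed

lemma generate_list_prod:
  assumes "S \<subseteq> carrier G" "g \<in> generate G S"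
  shows "\<exists>xs. set xs \<subseteq> conj_closure G S \<and> g = list_prod G xs"
  using assms(2)
proof (induction rule: generate.induct)
  case one
  show ?case by (intro exI[of _ "[]"]) (simp add: list_prod_def)
next
  case (incl h)
  then have "h = \<one> \<otimes> h \<otimes> inv \<one>" "h \<in> carrier G" using assms(1) by auto
  then have "h \<in> conj_closure G S" unfolding conj_closure_def using incl by blast
  with \<open>h \<in> carrier G\<close> show ?case by (intro exI[of _ "[h]"]) (simp add: list_prod_def)
next
  case (inv h)
  then have h: "inv h = \<one> \<otimes> inv h \<otimes> inv \<one>" "inv h \<in> carrier G" "inv (inv h) \<in> S"
    using assms(1) by (auto simp: subset_eq)
  then have "inv h \<in> conj_closure G S" unfolding conj_closure_def by blast
  with h(2) show ?case by (intro exI[of _ "[inv h]"]) (simp add: list_prod_def)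
next
  case (eng h1 h2)
  then obtain xs ys where "set xs \<subseteq> conj_closure G S" "h1 = list_prod G xs"
    "set ys \<subseteq> conj_closure G S" "h2 = list_prod G ys" by auto
  then show ?case using conj_closure_carrier[of S]
    by (intro exI[of _ "xs @ ys"]) (auto simp: list_prod_append)
qed

lemma biinv_norm_le:
  "set xs \<subseteq> conj_closure G S \<Longrightarrow> biinv_norm G S (list_prod G xs) \<le> length xs"
  unfolding biinv_norm_def by (rule Least_le) auto

lemma biinv_norm_attained:
  assumes "generating_set G S" "g \<in> carrier G"
  obtains xs where "length xs = biinv_norm G S g" "set xs \<subseteq> conj_closure G S" "g = list_prod G xs"
proof -
  have "\<exists>k xs. length xs = k \<and> set xs \<subseteq> conj_closure G S \<and> g = list_prod G xs"
    using generate_list_prod[of S g] assms by (auto simp: generating_set_def)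
  from LeastI_ex[OF this] show ?thesis using that unfolding biinv_norm_def by blast
qed

lemma biinv_norm_inv:
  assumes "generating_set G S" "g \<in> carrier G"
  shows "biinv_norm G S (inv g) = biinv_norm G S g"
proof -
  have *: "biinv_norm G S (inv h) \<le> biinv_norm G S h" if "h \<in> carrier G" for h
    using biinv_norm_attained[OF assms(1) that] list_prod_inv biinv_norm_le by metis
  show ?thesis using *[of g] *[of "inv g"] assms by auto
qed

lemma biinv_norm_conj:
  assumes "generating_set G S" "g \<in> carrier G" "h \<in> carrier G"
  shows "biinv_norm G S (h \<otimes> g \<otimes> inv h) = biinv_norm G S g"
proof -
  have *: "biinv_norm G S (k \<otimes> x \<otimes> inv k) \<le> biinv_norm G S x"
    if x: "x \<in> carrier G" and k: "k \<in> carrier G" for x k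
  proof -
    obtain xs where xs: "length xs = biinv_norm G S x" "set xs \<subseteq> conj_closure G S"
      "x = list_prod G xs" using biinv_norm_attained[OF assms(1) x] .
    have "set (map (\<lambda>y. k \<otimes> y \<otimes> inv k) xs) \<subseteq> conj_closure G S"
      using xs(2) conj_closure_conj k by auto
    from biinv_norm_le[OF this] show ?thesis
      using xs list_prod_conj[OF k, of xs] conj_closure_carrier[of S] by auto
  qed
  have "inv h \<otimes> (h \<otimes> g \<otimes> inv h) \<otimes> inv (inv h) = g"
    using assms by (simp add: m_assoc flip: m_assoc[of "inv h" h])
  then show ?thesis using *[of g h] *[of "h \<otimes> g \<otimes> inv h" "inv h"] assms by auto
qed

lemma biinv_norm_mult:
  assumes "generating_set G S" "g \<in> carrier G" "h \<in> carrier G"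
  shows "biinv_norm G S (g \<otimes> h) \<le> biinv_norm G S g + biinv_norm G S h"
proof -
  obtain xs where xs: "length xs = biinv_norm G S g" "set xs \<subseteq> conj_closure G S"
    "g = list_prod G xs" using biinv_norm_attained[OF assms(1,2)] .
  obtain ys where ys: "length ys = biinv_norm G S h" "set ys \<subseteq> conj_closure G S"
    "h = list_prod G ys" using biinv_norm_attained[OF assms(1,3)] .
  have "list_prod G (xs @ ys) = g \<otimes> h"
    using xs ys conj_closure_carrier[of S] by (subst list_prod_append) auto
  then show ?thesis using biinv_norm_le[of "xs @ ys" S] xs ys by auto
qed

lemma biinv_norm_eq_0:
  assumes "generating_set G S" "g \<in> carrier G"
  shows "biinv_norm G S g = 0 \<longleftrightarrow> g = \<one>"
proof
  assume "biinv_norm G S g = 0"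
  then show "g = \<one>" using biinv_norm_attained[OF assms] by (metis foldr_Nil id_apply length_0_conv list_prod_def)
next
  assume "g = \<one>"
  then show "biinv_norm G S g = 0" using biinv_norm_le[of "[]" S] by (simp add: list_prod_def)
qed

lemma Metric_space_biinv_dist:
  assumes S: "generating_set G S"
  shows "Metric_space (carrier G)
    (\<lambda>x y. if x \<in> carrier G \<and> y \<in> carrier G then biinv_dist G S x y else 0)"
proof -
  have comm: "biinv_dist G S x y = biinv_dist G S y x"
    if "x \<in> carrier G" "y \<in> carrier G" for x y
    using biinv_norm_inv[OF S, of "inv x \<otimes> y"] that
    by (simp add: biinv_dist_def inv_mult_group)
  have zero: "biinv_dist G S x y = 0 \<longleftrightarrow> x = y" if "x \<in> carrier G" "y \<in> carrier G" for x y
    using biinv_norm_eq_0[OF S, of "inv x \<otimes> y"] that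
    by (auto simp: biinv_dist_def inv_solve_left')
  have tri: "biinv_dist G S x z \<le> biinv_dist G S x y + biinv_dist G S y z"
    if "x \<in> carrier G" "y \<in> carrier G" "z \<in> carrier G" for x y z
  proof -
    have "inv x \<otimes> z = (inv x \<otimes> y) \<otimes> (inv y \<otimes> z)"
      using that by (simp add: m_assoc flip: m_assoc[of y "inv y"])
    then show ?thesis using biinv_norm_mult[OF S, of "inv x \<otimes> y" "inv y \<otimes> z"] that
      by (simp add: biinv_dist_def)
  qed
  have "0 \<le> biinv_dist G S x y" for x y by (simp add: biinv_dist_def)
  with comm zero tri show ?thesis by unfold_locales auto
qed

lemma biinv_dist_altdef:
  assumes S: "generating_set G S" and "x \<in> carrier G" "y \<in> carrier G"
  shows "biinv_dist G S x y = real (biinv_norm G S (x \<otimes> inv y))"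
proof -
  have "x \<otimes> inv y = inv (y \<otimes> (inv x \<otimes> y) \<otimes> inv y)"
    using assms by (simp add: inv_mult_group m_assoc)
  then show ?thesis using assms biinv_norm_inv[OF S] biinv_norm_conj[OF S]
    by (simp add: biinv_dist_def)
qed

end

end

(* An isomorphism changes word norms by bounded factors only. Conversely let phi be a quasi-isometry with
   image H. Brooks counting quasimorphisms grow linearly along the powers of any nontrivial element,
   while every quasimorphism is bounded by a linear function of the bi-invariant norm; as the kernel of
   phi is bounded, phi is injective. If H had infinite index, some positive word w would occur in no
   reduced word of H, because these words trace paths through finitely many cosets of H; the counting
   quasimorphism of w would vanish on H and be unbounded on the powers of w, although H is coarsely
   dense. So H has finite index. Finally, commutators [f, h^k] have bounded norm in F_n, so every
   homomorphism psi from H to the integers satisfies psi(f h f^-1) = psi(h) whenever both h and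
   f h f^-1 lie in H. Such homomorphisms arise from arbitrary edge weights on the coset graph of H, and
   weights concentrated on a single edge show that this graph has only one vertex, i.e. H = F_n. *)
theory Submission
  imports Defs "HOL-Library.Sublist"
begin

section \<open>Words\<close>

definition flip :: "'a \<times> bool \<Rightarrow> 'a \<times> bool" where
  "flip l = (fst l, \<not> snd l)"

definition flip_word :: "('a \<times> bool) list \<Rightarrow> ('a \<times> bool) list" where
  "flip_word w = rev (map flip w)"

text \<open>Phrased with \<open>successively\<close> because this splits over append;
  \<open>reduced_words_iff\<close> ties it to the indexed condition in
  \<open>reduced_words\<close>.\<close>

abbreviation reduced :: "('a \<times> bool) list \<Rightarrow> bool" where
  "reduced w \<equiv> successively (\<lambda>a b. b \<noteq> flip a) w"

lemma flip_flip [simp]: "flip (flip l) = l"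
  by (simp add: flip_def)

lemma flip_neq [simp]: "flip l \<noteq> l" "l \<noteq> flip l"
  by (auto simp: flip_def prod_eq_iff)

lemma flip_eq_iff: "flip k = l \<longleftrightarrow> k = flip l"
  by auto

lemma flip_word_simps [simp]:
  "flip_word [] = []" "flip_word (l # w) = flip_word w @ [flip l]"
  "flip_word (u @ v) = flip_word v @ flip_word u"
  by (simp_all add: flip_word_def)

lemma flip_word_flip_word [simp]: "flip_word (flip_word w) = w"
  by (induction w) auto

lemma length_flip_word [simp]: "length (flip_word w) = length w"
  by (simp add: flip_word_def)

lemma flip_word_eq_Nil [simp]: "flip_word w = [] \<longleftrightarrow> w = []"
  by (simp add: flip_word_def)

lemma flip_word_in_lists [simp]: "flip_word w \<in> lists (X \<times> UNIV) \<longleftrightarrow> w \<in> lists (X \<times> UNIV)"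
  by (induction w) (auto simp: flip_def)

lemma reduced_flip_word [simp]: "reduced (flip_word w) \<longleftrightarrow> reduced w"
  unfolding flip_word_def successively_rev successively_map
  by (intro arg_cong2[where f = successively]) (auto simp: fun_eq_iff flip_eq_iff)

text \<open>Without inverse letters nothing cancels, so such words can be concatenated and repeated
  freely and stay reduced.\<close>

abbreviation positive_word :: "'a list \<Rightarrow> ('a \<times> bool) list" where
  "positive_word as \<equiv> map (\<lambda>a. (a, True)) as"

lemma reduced_positive_word [simp]: "reduced (positive_word as)"
  by (induction as) (auto simp: successively_Cons hd_map flip_def)

lemma positive_word_in_lists [simp]: "positive_word as \<in> lists (X \<times> UNIV) \<longleftrightarrow> as \<in> lists X"
  by (induction as) auto

lemma reduced_words_iff: "w \<in> reduced_words X \<longleftrightarrow> w \<in> lists (X \<times> UNIV) \<and> reduced w"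
  unfolding reduced_words_def successively_conv_nth
  by (force simp: flip_def prod_eq_iff in_lists_conv_set)

text \<open>The last letter is the formal inverse of the first, and stripping both leaves a shorter
  word of the same kind. The descent can end neither at a single letter nor at two mutually inverse
  neighbours.\<close>

lemma flip_word_eq_self:
  assumes "reduced w" "flip_word w = w"
  shows "w = []"
  using assms
proof (induction "length w" arbitrary: w rule: less_induct)
  case less
  show ?case
  proof (cases w)
    case (Cons l v)
    show ?thesis
    proof (cases v rule: rev_cases)
      case Nil
      with Cons less.prems show ?thesis by simp
    next
      case (snoc u k)
      then have w: "w = l # u @ [flip l]" "flip_word u = u"
        using Cons less.prems by auto
      moreover have "reduced u"
        using less.prems(1) w(1) by (auto simp: successively_Cons successively_append_iff)
      ultimately have "u = []" using less.hyps by simp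
      with less.prems(1) w(1) show ?thesis by simp
    qed
  qed
qed

text \<open>\<open>c\<close> is the part that cancels in the product of \<open>a\<close> and
  \<open>b\<close>. Induction from the right end of \<open>a\<close>: either the junction is already
  reduced, or its two letters are mutually inverse and join the cancelled part.\<close>

lemma reduced_cancellation:
  assumes "reduced a" "reduced b"
  obtains u c v where "a = u @ c" "b = flip_word c @ v" "reduced (u @ v)"
proof -
  have "\<exists>u c v. a = u @ c \<and> b = flip_word c @ v \<and> reduced (u @ v)"
    using assms
  proof (induction a arbitrary: b rule: rev_induct)
    case Nil
    then show ?case by auto
  next
    case (snoc l a)
    show ?case
    proof (cases "reduced (a @ [l] @ b)")
      case True
      then show ?thesis by (intro exI[of _ "a @ [l]"] exI[of _ "[]"] exI[of _ b]) auto
    next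
      case False
      then have "b \<noteq> [] \<and> hd b = flip l"
        using snoc.prems by (auto simp: successively_append_iff successively_Cons)
      then obtain b' where b: "b = flip l # b'" by (cases b) auto
      then have "reduced a" "reduced b'"
        using snoc.prems by (auto simp: successively_append_iff successively_Cons)
      with snoc.IH obtain u c v where "a = u @ c" "b' = flip_word c @ v" "reduced (u @ v)"
        by blast
      with b show ?thesis
        by (intro exI[of _ u] exI[of _ "c @ [l]"] exI[of _ v]) auto
    qed
  qed
  with that show ?thesis by blast
qed

text \<open>Peel off the first and the last letter as long as they are mutually inverse. The
  condition \<open>reduced (u @ u)\<close> expresses that \<open>u\<close> is cyclically
  reduced.\<close>

lemma cyclically_reduced_core:
  assumes "reduced w" "w \<noteq> []"
  obtains p u where "w = p @ u @ flip_word p" "u \<noteq> []" "reduced (u @ u)"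
proof -
  have "\<exists>p u. w = p @ u @ flip_word p \<and> u \<noteq> [] \<and> reduced (u @ u)"
    using assms
  proof (induction "length w" arbitrary: w rule: less_induct)
    case less
    show ?case
    proof (cases "reduced (w @ w)")
      case True
      with less.prems show ?thesis by (intro exI[of _ "[]"] exI[of _ w]) auto
    next
      case False
      then have *: "hd w = flip (last w)"
        using less.prems by (auto simp: successively_append_iff)
      obtain v k where vk: "w = v @ [k]" using less.prems(2) by (cases w rule: rev_cases) auto
      with * obtain l v' where v: "v = l # v'" by (cases v) auto
      have w: "w = l # v' @ [flip l]" using * vk v by simp
      have "reduced v'" using less.prems(1) w by (auto simp: successively_Cons successively_append_iff)
      moreover have "v' \<noteq> []" using less.prems(1) w by auto
      ultimately obtain p u where "v' = p @ u @ flip_word p" "u \<noteq> []" "reduced (u @ u)"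
        using less.hyps[of v'] w by auto
      with w show ?thesis by (intro exI[of _ "l # p"] exI[of _ u]) auto
    qed
  qed
  with that show ?thesis by blast
qed

section \<open>Powers of words\<close>

definition word_power :: "'a list \<Rightarrow> nat \<Rightarrow> 'a list" where
  "word_power w k = concat (replicate k w)"

lemma word_power_simps [simp]:
  "word_power w 0 = []" "word_power w (Suc k) = w @ word_power w k"
  by (simp_all add: word_power_def)

lemma word_power_Suc': "word_power w (Suc k) = word_power w k @ w"
  by (induction k) auto

lemma flip_word_word_power: "flip_word (word_power w k) = word_power (flip_word w) k"
  by (induction k) (simp_all flip: word_power_Suc')

lemma reduced_word_power:
  assumes "reduced (w @ w)"
  shows "reduced (word_power w k)"
proof (induction k)
  case (Suc k)
  show ?case
  proof (cases k)
    case (Suc j)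
    with Suc.IH assms show ?thesis by (auto simp: successively_append_iff hd_append)
  qed (use assms in \<open>auto simp: successively_append_iff\<close>)
qed auto

lemma word_power_in_lists: "w \<in> lists A \<Longrightarrow> word_power w k \<in> lists A"
  by (induction k) auto

text \<open>Slide through the copies of \<open>u\<close>: a window starting inside the first copy
  takes a suffix of it and then a prefix of the next one.\<close>

lemma word_power_rotation:
  assumes "word_power u k = r @ v @ s" "length v = length u"
  shows "\<exists>x y. u = x @ y \<and> v = y @ x"
  using assms(1)
proof (induction k arbitrary: r)
  case 0
  with assms(2) show ?case by simp
next
  case (Suc k)
  then consider t where "r = u @ t" "word_power u k = t @ v @ s"
    | t where "u = r @ t" "t @ word_power u k = v @ s"
    by (auto simp: append_eq_append_conv2)
  then show ?case
  proof cases
    case 1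
    with Suc.IH show ?thesis by blast
  next
    case 2
    with assms(2) obtain v' where v': "v = t @ v'" "word_power u k = v' @ s"
      by (auto simp: append_eq_append_conv2)
    \<comment> \<open>\<open>v'\<close> has the length of \<open>r\<close> and starts the next copy
      of \<open>u = r @ t\<close>; without a next copy both are empty.\<close>
    have "v' = r"
    proof (cases k)
      case 0
      with 2 v' assms(2) show ?thesis by simp
    next
      case (Suc j)
      then have "r @ (t @ word_power u j) = v' @ s" using 2 v' by simp
      moreover have "length r = length v'" using 2 v' assms(2) by simp
      ultimately show ?thesis by simp
    qed
    with 2 v' show ?thesis by blast
  qed
qed

text \<open>Such an occurrence would be a rotation: \<open>w = x @ y\<close> with formal inverse
  \<open>y @ x\<close>. Then \<open>x\<close> and \<open>y\<close> are their own inverses, hence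
  empty.\<close>

lemma flip_word_not_sublist_word_power:
  assumes "reduced (w @ w)" "w \<noteq> []"
  shows "\<not> sublist (flip_word w) (word_power w k)"
proof
  assume "sublist (flip_word w) (word_power w k)"
  then obtain r s where "word_power w k = r @ flip_word w @ s" by (auto simp: sublist_def)
  from word_power_rotation[OF this] obtain x y where "w = x @ y" "flip_word w = y @ x"
    by auto
  then have "flip_word x = x" "flip_word y = y" by auto
  moreover have "reduced x" "reduced y"
    using assms(1) \<open>w = x @ y\<close> by (auto simp: successively_append_iff)
  ultimately show False using flip_word_eq_self \<open>w = x @ y\<close> assms(2) by blast
qed

section \<open>Counting occurrences, overlaps included, by their starting positions\<close>

fun occurrences :: "'a list \<Rightarrow> 'a list \<Rightarrow> nat" where
  "occurrences w [] = 0"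
| "occurrences w (l # u) = of_bool (prefix w (l # u)) + occurrences w u"

lemma occurrences_append_ge:
  "occurrences w u + occurrences w v \<le> occurrences w (u @ v)"
proof (induction u)
  case (Cons l u)
  have "prefix w (l # u) \<Longrightarrow> prefix w (l # u @ v)"
    using prefix_prefix[of w "l # u" v] by simp
  with Cons show ?case by (auto)
qed auto

text \<open>An occurrence in \<open>u @ v\<close> that lies in neither factor starts within the last
  \<open>length w\<close> letters of \<open>u\<close>.\<close>

lemma occurrences_append_le:
  "occurrences w (u @ v) \<le> occurrences w u + occurrences w v + length w"
proof -
  \<comment> \<open>The minimum makes the induction go through: while the remaining part of
    \<open>u\<close> is shorter than \<open>w\<close>, each further letter allows one more crossing
    occurrence.\<close>
  have "occurrences w (u @ v) \<le> occurrences w u + occurrences w v + min (length u) (length w)"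
  proof (induction u)
    case (Cons l u)
    show ?case
    proof (cases "length w \<le> length (l # u)")
      case True
      then have "prefix w (l # u @ v) \<longleftrightarrow> prefix w (l # u)"
        using prefix_length_prefix[of w "l # u @ v" "l # u"] prefix_prefix[of w "l # u" v]
        by (auto)
      with Cons True show ?thesis by (auto)
    next
      case False
      with Cons show ?thesis by (auto)
    qed
  qed auto
  then show ?thesis by linarith
qed

lemma occurrences_eq_0:
  assumes "\<not> sublist w u"
  shows "occurrences w u = 0"
  using assms
proof (induction u)
  case (Cons l u)
  then show ?case by (auto simp: sublist_Cons_right)
qed auto

lemma occurrences_word_power:
  assumes "w \<noteq> []"
  shows "k \<le> occurrences w (word_power w k)"
proof (induction k)
  case (Suc k)
  have "1 \<le> occurrences w w"
    using assms by (cases w) auto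
  with Suc occurrences_append_ge[of w w "word_power w k"] show ?case by simp
qed simp

section \<open>Free groups\<close>

locale based_free_group = group G for G (structure) +
  fixes X
  assumes free_basis: "free_basis G X"
begin

section \<open>Evaluation of words\<close>

abbreviation letters :: "('a \<times> bool) set" where "letters \<equiv> X \<times> UNIV"

lemma basis_closed [simp]: "a \<in> X \<Longrightarrow> a \<in> carrier G"
  using free_basis by (auto simp: free_basis_def)

lemma inv_mult_cancel [simp]:
  assumes "x \<in> carrier G" "y \<in> carrier G"
  shows "inv x \<otimes> (x \<otimes> y) = y" "x \<otimes> (inv x \<otimes> y) = y"
  using assms by (simp_all flip: m_assoc)

lemma eval_letter_closed [simp]: "l \<in> letters \<Longrightarrow> eval_letter G l \<in> carrier G"
  by (auto simp: eval_letter_def)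

lemma eval_letter_flip: "l \<in> letters \<Longrightarrow> eval_letter G (flip l) = inv (eval_letter G l)"
  by (auto simp: eval_letter_def flip_def)

lemma flip_letters [simp]: "flip l \<in> letters \<longleftrightarrow> l \<in> letters"
  by (cases l) (auto simp: flip_def)

lemma eval_word_simps [simp]:
  "eval_word G [] = \<one>"
  "eval_word G (l # w) = eval_letter G l \<otimes> eval_word G w"
  by (simp_all add: eval_word_def list_prod_def)

lemma eval_word_closed [simp]: "w \<in> lists letters \<Longrightarrow> eval_word G w \<in> carrier G"
  by (induction w) auto

lemma eval_word_append:
  "u \<in> lists letters \<Longrightarrow> v \<in> lists letters \<Longrightarrow> eval_word G (u @ v) = eval_word G u \<otimes> eval_word G v"
  by (induction u) (auto simp: m_assoc)

lemma eval_flip_word: "w \<in> lists letters \<Longrightarrow> eval_word G (flip_word w) = inv (eval_word G w)"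
  by (induction w) (auto simp: eval_word_append eval_letter_flip inv_mult_group)

lemma eval_word_power: "w \<in> lists letters \<Longrightarrow> eval_word G (word_power w k) = eval_word G w [^] k"
  by (induction k) (simp_all add: eval_word_append word_power_in_lists flip: nat_pow_Suc2)

section \<open>Normal forms and the Cayley tree\<close>

definition word_of :: "'a \<Rightarrow> ('a \<times> bool) list" where
  "word_of = the_inv_into (reduced_words X) (eval_word G)"

lemma bij_eval_word: "bij_betw (eval_word G) (reduced_words X) (carrier G)"
  using free_basis by (simp add: free_basis_def)

lemma word_of_reduced_words: "x \<in> carrier G \<Longrightarrow> word_of x \<in> reduced_words X"
  using bij_eval_word the_inv_into_into[of "eval_word G" "reduced_words X" x "reduced_words X"]
  by (auto simp: word_of_def bij_betw_def)

lemma reduced_word_of [simp]: "x \<in> carrier G \<Longrightarrow> reduced (word_of x)"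
  and word_of_in_lists [simp]: "x \<in> carrier G \<Longrightarrow> word_of x \<in> lists letters"
  using word_of_reduced_words by (auto simp only: reduced_words_iff)

lemma eval_word_of [simp]: "x \<in> carrier G \<Longrightarrow> eval_word G (word_of x) = x"
  unfolding word_of_def using bij_eval_word f_the_inv_into_f_bij_betw by metis

lemma word_of_eval: "w \<in> lists letters \<Longrightarrow> reduced w \<Longrightarrow> word_of (eval_word G w) = w"
  unfolding word_of_def using bij_eval_word
  by (intro the_inv_into_f_f) (auto simp: bij_betw_def reduced_words_iff)

lemma word_of_eqI:
  "w \<in> lists letters \<Longrightarrow> reduced w \<Longrightarrow> eval_word G w = x \<Longrightarrow> word_of x = w"
  using word_of_eval by auto

lemma word_of_one [simp]: "word_of \<one> = []"
  by (rule word_of_eqI) auto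

lemma word_of_inv: "x \<in> carrier G \<Longrightarrow> word_of (inv x) = flip_word (word_of x)"
  by (rule word_of_eqI) (simp_all add: eval_flip_word)

text \<open>One step in the Cayley tree, either away from the identity or back towards it.\<close>

lemma word_of_mult_letter:
  assumes x: "x \<in> carrier G" and l: "l \<in> letters"
  obtains "word_of (x \<otimes> eval_letter G l) = word_of x @ [l]"
  | "word_of x = word_of (x \<otimes> eval_letter G l) @ [flip l]"
proof (cases "reduced (word_of x @ [l])")
  case True
  have "word_of (x \<otimes> eval_letter G l) = word_of x @ [l]"
    using x l True by (intro word_of_eqI) (auto simp: eval_word_append)
  with that show ?thesis by blast
next
  case False
  then have "word_of x \<noteq> []" "last (word_of x) = flip l"
    using x by (auto simp: successively_append_iff)
  then obtain u where u: "word_of x = u @ [flip l]"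
    by (metis append_butlast_last_id)
  then have "u \<in> lists letters" "reduced u"
    using x word_of_in_lists[of x] reduced_word_of[of x] by (auto simp: successively_append_iff)
  moreover have "x = eval_word G u \<otimes> inv (eval_letter G l)"
    using eval_word_of[OF x] u \<open>u \<in> lists letters\<close> l
    by (simp add: eval_word_append eval_letter_flip)
  ultimately have "word_of (x \<otimes> eval_letter G l) = u"
    using l by (intro word_of_eqI) (auto simp: m_assoc)
  with u that show ?thesis by blast
qed

text \<open>In a tree every path visits all vertices of the geodesic between its ends. Here the path
  spells \<open>u\<close> from the identity, and each further letter extends or shortens the
  geodesic by one edge.\<close>

lemma prefix_word_of_eval:
  assumes "u \<in> lists letters" "prefix r (word_of (eval_word G u))"
  shows "\<exists>r'. prefix r' u \<and> eval_word G r = eval_word G r'"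
  using assms
proof (induction u arbitrary: r rule: rev_induct)
  case Nil
  then show ?case by simp
next
  case (snoc l u)
  have u: "u \<in> lists letters" and l: "l \<in> letters" using snoc.prems by auto
  have e: "eval_word G (u @ [l]) = eval_word G u \<otimes> eval_letter G l"
    using u l by (simp add: eval_word_append)
  show ?case
  proof (cases "r = word_of (eval_word G (u @ [l]))")
    case True
    with snoc.prems show ?thesis by (intro exI[of _ "u @ [l]"]) auto
  next
    case False
    have "prefix r (word_of (eval_word G u))"
      using eval_word_closed[OF u] l
    proof (cases rule: word_of_mult_letter)
      case 1
      with snoc.prems(2) False show ?thesis by (auto simp: e prefix_snoc)
    next
      case 2
      with snoc.prems(2) show ?thesis by (auto simp: e prefix_def)
    qed
    with snoc.IH u obtain r' where "prefix r' u" "eval_word G r = eval_word G r'" by blast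
    then show ?thesis by (intro exI[of _ r']) (auto simp: prefix_append)
  qed
qed

section \<open>Induction and edge weights on the Cayley graph\<close>

lemma carrier_induct [consumes 1, case_names one basis inv_basis]:
  assumes "x \<in> carrier G" "P \<one>"
    and "\<And>x a. x \<in> carrier G \<Longrightarrow> a \<in> X \<Longrightarrow> P x \<Longrightarrow> P (x \<otimes> a)"
    and "\<And>x a. x \<in> carrier G \<Longrightarrow> a \<in> X \<Longrightarrow> P x \<Longrightarrow> P (x \<otimes> inv a)"
  shows "P x"
proof -
  have "P (eval_word G w)" if "w \<in> lists letters" for w
    using that
  proof (induction w rule: rev_induct)
    case Nil
    then show ?case using assms(2) by simp
  next
    case (snoc l w)
    then show ?case using assms(3,4)
      by (cases l; cases "snd l") (auto simp: eval_word_append eval_letter_def)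
  qed
  from this[of "word_of x"] assms(1) show ?thesis by simp
qed

lemma mult_inv_cancel [simp]:
  "x \<in> carrier G \<Longrightarrow> y \<in> carrier G \<Longrightarrow> x \<otimes> y \<otimes> inv y = x"
  "x \<in> carrier G \<Longrightarrow> y \<in> carrier G \<Longrightarrow> x \<otimes> inv y \<otimes> y = x"
  by (simp_all add: m_assoc)

text \<open>\<open>\<beta> x a\<close> is the weight of the edge from \<open>x\<close> to
  \<open>x \<otimes> a\<close>. An inverse letter runs through its edge backwards, so the weight is
  read at the far end and counted negatively.\<close>

primrec path_sum :: "('a \<Rightarrow> 'a \<Rightarrow> int) \<Rightarrow> 'a \<Rightarrow> ('a \<times> bool) list \<Rightarrow> int" where
  "path_sum \<beta> x [] = 0"
| "path_sum \<beta> x (l # w) =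
     (if snd l then \<beta> x (fst l) else - \<beta> (x \<otimes> eval_letter G l) (fst l))
     + path_sum \<beta> (x \<otimes> eval_letter G l) w"

lemma path_sum_append:
  assumes "x \<in> carrier G" "u \<in> lists letters" "v \<in> lists letters"
  shows "path_sum \<beta> x (u @ v) = path_sum \<beta> x u + path_sum \<beta> (x \<otimes> eval_word G u) v"
  using assms by (induction u arbitrary: x) (auto simp: m_assoc)

text \<open>The Cayley graph is a tree, so the increments along its edges can be prescribed freely.\<close>

lemma potential_exists:
  obtains D :: "'a \<Rightarrow> int" where "D \<one> = 0"
    and "\<And>x a. x \<in> carrier G \<Longrightarrow> a \<in> X \<Longrightarrow> D (x \<otimes> a) = D x + \<beta> x a"
proof -
  let ?D = "\<lambda>x. path_sum \<beta> \<one> (word_of x)"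
  have "?D (x \<otimes> a) = ?D x + \<beta> x a" if x: "x \<in> carrier G" and a: "a \<in> X" for x a
  proof -
    let ?l = "(a, True)"
    have l: "?l \<in> letters" and e: "eval_letter G ?l = a" using a by (auto simp: eval_letter_def)
    show ?thesis
      using x l
    proof (cases rule: word_of_mult_letter)
      case 1
      with x a show ?thesis by (simp add: e path_sum_append)
    next
      case 2
      \<comment> \<open>Here the geodesic to \<open>x\<close> passes through
        \<open>x \<otimes> a\<close> and ends by traversing the edge backwards.\<close>
      have "?D x = path_sum \<beta> \<one> (word_of (x \<otimes> a) @ [(a, False)])"
        using 2 by (simp add: e flip_def)
      also have "\<dots> = ?D (x \<otimes> a) - \<beta> x a"
        using x a by (subst path_sum_append) (simp_all add: eval_letter_def)
      finally show ?thesis by simp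
    qed
  qed
  then show thesis by (intro that[of ?D]) simp_all
qed

end

section \<open>Quasimorphisms\<close>

definition quasimorphism :: "('a, 'b) monoid_scheme \<Rightarrow> ('a \<Rightarrow> real) \<Rightarrow> bool" where
  "quasimorphism G f \<longleftrightarrow>
     (\<exists>D. \<forall>x\<in>carrier G. \<forall>y\<in>carrier G. \<bar>f (x \<otimes>\<^bsub>G\<^esub> y) - f x - f y\<bar> \<le> D)"

context group
begin

lemma conj_pow:
  assumes "g \<in> carrier G" "x \<in> carrier G"
  shows "(g \<otimes> x \<otimes> inv g) [^] (k::nat) = g \<otimes> x [^] k \<otimes> inv g"
proof (induction k)
  case (Suc k)
  have "inv g \<otimes> (g \<otimes> (x \<otimes> inv g)) = x \<otimes> inv g"
    using assms by (simp flip: m_assoc)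
  with Suc assms show ?case by (simp add: m_assoc)
qed (use assms in simp)

text \<open>Evaluate \<open>f\<close> along a shortest factorization of \<open>x\<close> over the
  conjugation closure; \<open>f \<one>\<close> is left over for the empty product. This serves
  quasimorphisms and pulled-back norms alike.\<close>

lemma subadditive_le_biinv_norm:
  fixes f :: "'a \<Rightarrow> real"
  assumes "generating_set G S" "x \<in> carrier G"
    and sub: "\<And>x y. x \<in> carrier G \<Longrightarrow> y \<in> carrier G \<Longrightarrow> f (x \<otimes> y) \<le> f x + f y"
    and le: "\<And>s. s \<in> conj_closure G S \<Longrightarrow> f s \<le> M"
  shows "f x \<le> M * biinv_norm G S x + f \<one>"
proof -
  have "f (list_prod G xs) \<le> M * length xs + f \<one>" if "set xs \<subseteq> conj_closure G S" for xs
    using that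
  proof (induction xs)
    case Nil
    then show ?case by (simp add: list_prod_def)
  next
    case (Cons s xs)
    then have "s \<in> carrier G" "list_prod G xs \<in> carrier G"
      using conj_closure_carrier[of S] list_prod_closed[of xs] by auto
    then have "f (list_prod G (s # xs)) \<le> f s + f (list_prod G xs)"
      using sub by (simp add: list_prod_def)
    with Cons le[of s] show ?case by (auto simp: algebra_simps)
  qed
  with biinv_norm_attained[OF assms(1,2)] show ?thesis by metis
qed

text \<open>Adding the defect \<open>D\<close> to the absolute value of \<open>f\<close> makes it
  subadditive. Conjugation changes a quasimorphism by a bounded amount only, so finitely many
  generators bound it on their whole conjugation closure.\<close>

lemma quasimorphism_le_biinv_norm:
  assumes f: "quasimorphism G f" and S: "generating_set G S" "finite S"
  obtains A B :: real where "A \<ge> 0" "B \<ge> 0" "\<And>x. x \<in> carrier G \<Longrightarrow> \<bar>f x\<bar> \<le> A * biinv_norm G S x + B"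
proof -
  obtain D where D: "\<bar>f (x \<otimes> y) - f x - f y\<bar> \<le> D" if "x \<in> carrier G" "y \<in> carrier G" for x y
    using f by (auto simp: quasimorphism_def)
  have f1: "\<bar>f \<one>\<bar> \<le> D" using D[of \<one> \<one>] by simp
  define M where "M = (\<Sum>s\<in>S \<union> (\<lambda>s. inv s) ` S. \<bar>f s\<bar>)"
  have M: "\<bar>f s\<bar> \<le> M" if "s \<in> S \<union> (\<lambda>s. inv s) ` S" for s
    unfolding M_def using that S(2) by (intro member_le_sum) auto
  have "M \<ge> 0" unfolding M_def by (intro sum_nonneg) auto
  \<comment> \<open>The defect enters four times: for two products, for
    \<open>g \<otimes> inv g\<close> and for the bound on \<open>f \<one>\<close>; the fifth is the
    \<open>D\<close> added on the left.\<close>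
  have conj: "\<bar>f s\<bar> + D \<le> M + 5 * D" if s: "s \<in> conj_closure G S" for s
  proof -
    obtain g t where gt: "s = g \<otimes> t \<otimes> inv g" "g \<in> carrier G" "t \<in> carrier G" "t \<in> S \<or> inv t \<in> S"
      using s by (auto simp: conj_closure_def)
    then have "t \<in> S \<union> (\<lambda>s. inv s) ` S"
      by (metis UnCI image_eqI inv_inv)
    with M[of t] D[of "g \<otimes> t" "inv g"] D[of g t] D[of g "inv g"] f1 gt show ?thesis by auto
  qed
  show thesis
  proof (rule that[of "M + 5 * D" "2 * D"])
    fix x assume "x \<in> carrier G"
    moreover have "\<bar>f (x \<otimes> y)\<bar> + D \<le> (\<bar>f x\<bar> + D) + (\<bar>f y\<bar> + D)"
      if "x \<in> carrier G" "y \<in> carrier G" for x y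
      using D[OF that] by linarith
    ultimately have "\<bar>f x\<bar> + D \<le> (M + 5 * D) * biinv_norm G S x + (\<bar>f \<one>\<bar> + D)"
      using conj by (intro subadditive_le_biinv_norm[OF S(1)]) auto
    with f1 show "\<bar>f x\<bar> \<le> (M + 5 * D) * biinv_norm G S x + 2 * D" by linarith
  qed (use f1 \<open>M \<ge> 0\<close> in linarith)+
qed

end

context based_free_group
begin

text \<open>Brooks' counting quasimorphism, written with the inverse element instead of the inverse word so
  that its antisymmetry is immediate.\<close>

definition counting :: "('a \<times> bool) list \<Rightarrow> 'a \<Rightarrow> real" where
  "counting w x = real (occurrences w (word_of x)) - real (occurrences w (word_of (inv x)))"

text \<open>Let \<open>c\<close> be the part cancelled in the product. Its contributions to
  \<open>x\<close> and \<open>y\<close> cancel by antisymmetry, so only junction errors remain: six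
  concatenations, each costing at most \<open>length w\<close>.\<close>

lemma quasimorphism_counting: "quasimorphism G (counting w)"
  unfolding quasimorphism_def
proof (intro exI ballI)
  fix x y assume xy: "x \<in> carrier G" "y \<in> carrier G"
  obtain u c v where ucv: "word_of x = u @ c" "word_of y = flip_word c @ v" "reduced (u @ v)"
    using reduced_cancellation reduced_word_of xy by metis
  have lists: "u \<in> lists letters" "c \<in> lists letters" "v \<in> lists letters"
    using word_of_in_lists[OF xy(1)] word_of_in_lists[OF xy(2)] ucv by auto
  have "x = eval_word G (u @ c)" "y = eval_word G (flip_word c @ v)"
    using ucv xy eval_word_of by metis+
  then have "word_of (x \<otimes> y) = u @ v"
    using lists ucv(3) by (intro word_of_eqI) (simp_all add: eval_word_append eval_flip_word m_assoc)
  moreover have app: "\<bar>real (occurrences w (a @ b)) - (occurrences w a + occurrences w b)\<bar> \<le> length w" for a b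
    using occurrences_append_ge[of w a b] occurrences_append_le[of w a b] by linarith
  moreover have "counting w x = real (occurrences w (u @ c)) - real (occurrences w (flip_word c @ flip_word u))"
    "counting w y = real (occurrences w (flip_word c @ v)) - real (occurrences w (flip_word v @ c))"
    using ucv xy by (simp_all add: counting_def word_of_inv)
  moreover have "counting w (x \<otimes> y) = real (occurrences w (u @ v)) - real (occurrences w (flip_word v @ flip_word u))"
    using \<open>word_of (x \<otimes> y) = u @ v\<close> xy by (simp add: counting_def word_of_inv)
  ultimately show "\<bar>counting w (x \<otimes> y) - counting w x - counting w y\<bar> \<le> 6 * length w"
    using app[of u v] app[of u c] app[of "flip_word c" v]
      app[of "flip_word v" "flip_word u"] app[of "flip_word c" "flip_word u"] app[of "flip_word v" c]
    by linarith
qed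

text \<open>As \<open>w\<close> is cyclically reduced, \<open>word_power w k\<close> is the normal
  form of the power. Each of its factors is a copy of \<open>w\<close>, while its formal inverse
  contains none.\<close>

lemma counting_power_ge:
  assumes "w \<in> lists letters" "w \<noteq> []" "reduced (w @ w)"
  shows "real k \<le> counting w (eval_word G w [^] k)"
proof -
  have "word_of (eval_word G w [^] k) = word_power w k"
    using assms by (intro word_of_eqI) (simp_all add: eval_word_power word_power_in_lists reduced_word_power)
  moreover have "occurrences w (flip_word (word_power w k)) = 0"
    using flip_word_not_sublist_word_power[of "flip_word w" k] assms
    by (intro occurrences_eq_0) (simp add: flip_word_word_power flip: flip_word_simps(3))
  ultimately show ?thesis
    using occurrences_word_power[OF assms(2), of k] assms(1)
    by (simp add: counting_def word_of_inv)
qed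

text \<open>The norm is conjugation invariant, so pass to the cyclically reduced core
  \<open>u\<close> of \<open>x\<close>. On its powers the counting quasimorphism of \<open>u\<close>
  grows linearly, and the norm controls it.\<close>

lemma biinv_norm_powers_unbounded:
  assumes S: "generating_set G S" "finite S" and x: "x \<in> carrier G" "x \<noteq> \<one>"
  obtains k :: nat where "biinv_norm G S (x [^] k) > c"
proof -
  have "word_of x \<noteq> []" using x eval_word_of eval_word_simps(1) by metis
  then obtain p u where pu: "word_of x = p @ u @ flip_word p" "u \<noteq> []" "reduced (u @ u)"
    using cyclically_reduced_core reduced_word_of x(1) by metis
  then have lists: "p \<in> lists letters" "u \<in> lists letters"
    using word_of_in_lists[OF x(1)] by auto
  define g y where "g = eval_word G p" and "y = eval_word G u"
  have gy: "g \<in> carrier G" "y \<in> carrier G" using lists by (simp_all add: g_def y_def)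
  have "x = g \<otimes> y \<otimes> inv g"
    using eval_word_of[OF x(1)] pu(1) lists
    by (simp add: eval_word_append eval_flip_word g_def y_def m_assoc)
  then have "x [^] k = g \<otimes> y [^] k \<otimes> inv g" for k :: nat
    using gy by (simp add: conj_pow)
  then have norm: "biinv_norm G S (x [^] k) = biinv_norm G S (y [^] k)" for k :: nat
    using biinv_norm_conj[OF S(1)] gy by simp
  obtain A B :: real where AB: "A \<ge> 0" "\<And>z. z \<in> carrier G \<Longrightarrow> \<bar>counting u z\<bar> \<le> A * biinv_norm G S z + B"
    using quasimorphism_le_biinv_norm[OF quasimorphism_counting S] by metis
  obtain k :: nat where k: "A * c + B < k" using reals_Archimedean2 by blast
  have "real k \<le> A * biinv_norm G S (y [^] k) + B"
    using AB(2)[of "y [^] k"] counting_power_ge[OF lists(2) pu(2,3), of k] gy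
    by (simp add: y_def)
  with k have "A * c < A * biinv_norm G S (y [^] k)" by linarith
  then have "c < biinv_norm G S (x [^] k)"
    using AB(1) norm by (simp add: mult_less_cancel_left)
  with that show thesis by blast
qed

end

section \<open>Coarsely dense subgroups\<close>

context group
begin

lemma set_mult_iff: "x \<in> H <#> P \<longleftrightarrow> (\<exists>h\<in>H. \<exists>p\<in>P. x = h \<otimes> p)"
  by (auto simp: set_mult_def)

lemma subgroup_set_mult_absorb:
  assumes "subgroup H G" "P \<subseteq> carrier G" "h \<in> H" "x \<in> H <#> P"
  shows "h \<otimes> x \<in> H <#> P"
proof -
  obtain k p where kp: "k \<in> H" "p \<in> P" "x = k \<otimes> p" using assms(4) by (auto simp: set_mult_iff)
  then have "h \<otimes> x = (h \<otimes> k) \<otimes> p"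
    using assms(1-3) subgroup.mem_carrier[OF assms(1)] by (auto simp: m_assoc)
  then show ?thesis
    using kp subgroup.m_closed[OF assms(1,3)] unfolding set_mult_iff by blast
qed

text \<open>The coset of \<open>x \<otimes> y [^] i\<close> is that of a representative in the
  finite set \<open>P\<close>, so two exponents share a representative.\<close>

lemma coset_pigeonhole:
  assumes H: "subgroup H G" and P: "finite P" "P \<subseteq> carrier G"
    and xy: "x \<in> carrier G" "y \<in> carrier G"
    and in_HP: "\<And>i::nat. x \<otimes> y [^] i \<in> H <#> P"
  obtains i j :: nat and h where "i < j" "h \<in> H" "x \<otimes> y [^] i = h \<otimes> (x \<otimes> y [^] j)"
proof -
  have "\<forall>i::nat. \<exists>h p. h \<in> H \<and> p \<in> P \<and> x \<otimes> y [^] i = h \<otimes> p"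
    using in_HP unfolding set_mult_iff by blast
  then obtain h p where hp: "\<And>i::nat. h i \<in> H" "\<And>i. p i \<in> P" "\<And>i. x \<otimes> y [^] i = h i \<otimes> p i"
    by metis
  have "\<not> inj p"
    using hp(2) P(1) by (meson finite_subset image_subset_iff infinite_UNIV_nat finite_imageD)
  then obtain i j where ij: "i < j" "p i = p j"
    unfolding inj_def by (metis linorder_neqE_nat)
  have c: "h i \<in> carrier G" "h j \<in> carrier G" "p j \<in> carrier G"
    using hp P(2) subgroup.mem_carrier[OF H] by auto
  have "x \<otimes> y [^] i = (h i \<otimes> inv (h j)) \<otimes> (x \<otimes> y [^] j)"
    using c ij(2) hp(3)[of i] hp(3)[of j] by (simp add: m_assoc) (simp flip: m_assoc)
  with ij(1) hp(1) H that show thesis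
    by (meson subgroup.m_closed subgroup.m_inv_closed)
qed

text \<open>Two powers of \<open>g\<close> lie in the same coset, and their quotient lies in
  \<open>H\<close>.\<close>

lemma finite_index_power:
  assumes H: "subgroup H G" and P: "finite P" "P \<subseteq> carrier G" and cover: "carrier G = H <#> P"
    and g: "g \<in> carrier G"
  obtains e :: nat where "e > 0" "g [^] e \<in> H"
proof -
  have "\<one> \<otimes> g [^] i \<in> H <#> P" for i :: nat
    using g unfolding cover[symmetric] by simp
  from coset_pigeonhole[OF H P one_closed g this]
  obtain i j :: nat and h where ij: "i < j" "h \<in> H" "\<one> \<otimes> g [^] i = h \<otimes> (\<one> \<otimes> g [^] j)" .
  have h: "h \<in> carrier G" using subgroup.mem_carrier[OF H ij(2)] .
  have "g [^] j = g [^] (j - i) \<otimes> g [^] i" using ij(1) g by (simp add: nat_pow_mult)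
  then have "\<one> \<otimes> g [^] i = (h \<otimes> g [^] (j - i)) \<otimes> g [^] i" using ij(3) g h by (simp add: m_assoc)
  then have "\<one> = h \<otimes> g [^] (j - i)" using g h by (simp only: right_cancel one_closed nat_pow_closed m_closed)
  then have "g [^] (j - i) = inv h" using g h by (metis inv_equality inv_inv nat_pow_closed)
  then show thesis using that[of "j - i"] ij H by (simp add: subgroup.m_inv_closed)
qed

end

context based_free_group
begin

section \<open>Paths in the coset graph\<close>

lemma eval_positive_word_snoc:
  "as \<in> lists X \<Longrightarrow> a \<in> X \<Longrightarrow>
     eval_word G (positive_word (as @ [a])) = eval_word G (positive_word as) \<otimes> a"
  by (simp add: eval_word_append eval_letter_def)

lemma eval_positive_word_replicate:
  "a \<in> X \<Longrightarrow> eval_word G (positive_word (replicate k a)) = a [^] k"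
  by (induction k) (simp_all add: eval_letter_def flip: nat_pow_Suc2)

text \<open>This is a finite core of the coset graph, as in Stallings' construction. For a product,
  the concatenated path visits every vertex of the reduced one; its second half is the path of
  \<open>h2\<close> translated by \<open>h1\<close>, and such translations preserve
  \<open>H <#> P\<close>.\<close>

lemma finitely_many_prefix_cosets:
  assumes T: "finite T" "T \<subseteq> carrier G" and H: "H = generate G T"
  obtains P where "finite P" "P \<subseteq> carrier G" "\<one> \<in> P"
    and "\<And>h r. h \<in> H \<Longrightarrow> prefix r (word_of h) \<Longrightarrow> eval_word G r \<in> H <#> P"
proof -
  define P where "P = insert \<one> (\<Union>t\<in>T \<union> (\<lambda>t. inv t) ` T. eval_word G ` set (prefixes (word_of t)))"
  have sub: "subgroup H G" using H generate_is_subgroup[OF T(2)] by simp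
  have HG: "h \<in> carrier G" if "h \<in> H" for h using subgroup.mem_carrier[OF sub that] .
  have "finite P" using T by (simp add: P_def)
  have prefix_lists: "r \<in> lists letters" if "prefix r (word_of x)" "x \<in> carrier G" for r x
    using that word_of_in_lists[of x] by (metis append_in_lists_conv prefix_def)
  have "P \<subseteq> carrier G" unfolding P_def using T(2) prefix_lists by auto
  have P_sub: "p \<in> H <#> P" if "p \<in> P" for p
    using that \<open>P \<subseteq> carrier G\<close> subgroup.one_closed[OF sub] by (force simp: set_mult_iff)
  have gens: "eval_word G r \<in> P" if "t \<in> T \<union> (\<lambda>t. inv t) ` T" "prefix r (word_of t)" for t r
    using that unfolding P_def by (intro insertI2 UN_I[of t]) auto
  have main: "eval_word G r \<in> H <#> P" if "h \<in> generate G T" "prefix r (word_of h)" for h r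
    using that
  proof (induction arbitrary: r rule: generate.induct)
    case one
    then show ?case using P_sub[of \<one>] by (simp add: P_def)
  next
    case (incl h)
    then show ?case using P_sub gens by auto
  next
    case (inv h)
    then show ?case using P_sub gens by auto
  next
    case (eng h1 h2)
    have h: "h1 \<in> H" "h2 \<in> H" using eng H by auto
    let ?u = "word_of h1 @ word_of h2"
    have "?u \<in> lists letters" "eval_word G ?u = h1 \<otimes> h2"
      using h HG by (simp_all add: eval_word_append)
    with eng.prems prefix_word_of_eval[of ?u r]
    obtain r' where r': "prefix r' ?u" "eval_word G r = eval_word G r'" by auto
    then consider "prefix r' (word_of h1)" | s where "r' = word_of h1 @ s" "prefix s (word_of h2)"
      by (auto simp: prefix_append)
    then show ?case
    proof cases
      case 1
      with eng.IH(1) r' show ?thesis by auto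
    next
      case 2
      then have "eval_word G r' = h1 \<otimes> eval_word G s"
        using h HG prefix_lists by (simp add: eval_word_append)
      moreover have "eval_word G s \<in> H <#> P" using eng.IH(2) 2 by blast
      ultimately show ?thesis
        using r' subgroup_set_mult_absorb[OF sub \<open>P \<subseteq> carrier G\<close> h(1)] by auto
    qed
  qed
  show thesis
    using that[OF \<open>finite P\<close> \<open>P \<subseteq> carrier G\<close>] main H by (auto simp: P_def)
qed

text \<open>Positive words suffice: if all of them stayed in the finite set \<open>H <#> P\<close> of cosets, each
  generator would permute the cosets reached from \<open>p\<close>, which would thus be all cosets.\<close>

lemma positive_word_leaving_cosets:
  assumes H: "subgroup H G" and P: "finite P" "P \<subseteq> carrier G"
    and y: "y \<in> carrier G" "y \<notin> H <#> P" and p: "p \<in> carrier G"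
  obtains as where "as \<in> lists X" "p \<otimes> eval_word G (positive_word as) \<notin> H <#> P"
proof (rule ccontr)
  note avoid = that
  assume no_thesis: "\<not> thesis"
  have all: "p \<otimes> eval_word G (positive_word as) \<in> H <#> P" if as: "as \<in> lists X" for as
    using as no_thesis avoid by blast
  have HG: "h \<in> carrier G" if "h \<in> H" for h using subgroup.mem_carrier[OF H that] .
  have "\<exists>h as. h \<in> H \<and> as \<in> lists X \<and> p \<otimes> g = h \<otimes> (p \<otimes> eval_word G (positive_word as))"
    if "g \<in> carrier G" for g
    using that
  proof (induction g rule: carrier_induct)
    case one
    show ?case using subgroup.one_closed[OF H] p
      by (intro exI[of _ \<one>] exI[of _ "[]"]) auto
  next
    case (basis g a)
    then obtain h as where h: "h \<in> H" "as \<in> lists X" "p \<otimes> g = h \<otimes> (p \<otimes> eval_word G (positive_word as))"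
      by blast
    have "p \<otimes> (g \<otimes> a) = p \<otimes> g \<otimes> a" using p basis by (simp add: m_assoc)
    also have "\<dots> = h \<otimes> (p \<otimes> eval_word G (positive_word (as @ [a])))"
      using p basis h HG unfolding h(3) eval_positive_word_snoc[OF h(2) basis(2)] by (simp add: m_assoc)
    finally show ?case using h basis by (intro exI[of _ h] exI[of _ "as @ [a]"]) auto
  next
    case (inv_basis g a)
    then obtain h as where h: "h \<in> H" "as \<in> lists X" "p \<otimes> g = h \<otimes> (p \<otimes> eval_word G (positive_word as))"
      by blast
    define x where "x = p \<otimes> eval_word G (positive_word as)"
    have x: "x \<in> carrier G" using p h by (simp add: x_def)
    have a: "a \<in> carrier G" using inv_basis by simp
    have pow: "x \<otimes> a [^] i = p \<otimes> eval_word G (positive_word (as @ replicate i a))" for i :: nat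
      using p h inv_basis
      by (simp add: x_def eval_word_append eval_positive_word_replicate[simplified] m_assoc
          in_lists_conv_set)
    have lists: "as @ replicate i a \<in> lists X" for i using h inv_basis by auto
    \<comment> \<open>A repeated coset among the \<open>x \<otimes> a [^] i\<close> replaces the
      backward step along \<open>a\<close> by \<open>j - Suc i\<close> forward steps, up to an
      element of \<open>H\<close>.\<close>
    obtain i j :: nat and k where ij: "i < j" "k \<in> H" "x \<otimes> a [^] i = k \<otimes> (x \<otimes> a [^] j)"
      using coset_pigeonhole[OF H P x a] pow all[OF lists] by metis
    have "a [^] j = a [^] (j - Suc i) \<otimes> a [^] Suc i"
      using nat_pow_mult[OF a] ij(1) by (metis Suc_leI le_add_diff_inverse2)
    then have "x \<otimes> a [^] i = (k \<otimes> (x \<otimes> a [^] (j - Suc i))) \<otimes> a [^] Suc i"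
      using ij(2,3) a x HG by (simp add: m_assoc)
    moreover have "inv a \<otimes> a [^] Suc i = a [^] i"
      using a by (metis inv_mult_cancel(1) nat_pow_Suc2 nat_pow_closed)
    then have "(x \<otimes> inv a) \<otimes> a [^] Suc i = x \<otimes> a [^] i"
      using a x by (metis inv_closed m_assoc nat_pow_closed)
    ultimately have "(x \<otimes> inv a) \<otimes> a [^] Suc i = (k \<otimes> (x \<otimes> a [^] (j - Suc i))) \<otimes> a [^] Suc i"
      by simp
    then have "x \<otimes> inv a = k \<otimes> (x \<otimes> a [^] (j - Suc i))"
      using a x HG ij(2) by (simp only: right_cancel inv_closed nat_pow_closed m_closed)
    then have "p \<otimes> (g \<otimes> inv a) = h \<otimes> k \<otimes> (x \<otimes> a [^] (j - Suc i))"
      using h(1,3) x a p inv_basis(1) ij(2) HG by (simp add: m_assoc flip: x_def)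
        (metis m_assoc inv_closed m_closed)
    then show ?case unfolding pow
      using subgroup.m_closed[OF H h(1) ij(2)] lists by blast
  qed
  \<comment> \<open>At this element the claim describes \<open>y\<close> itself and places it in
    \<open>H <#> P\<close>.\<close>
  from this[of "inv p \<otimes> y"] p y all subgroup_set_mult_absorb[OF H P(2)] show False
    by (metis inv_closed inv_mult_cancel(2) m_closed)
qed

text \<open>Treat the elements of \<open>Q\<close> one after another, extending the word until its
  path from the new \<open>q\<close> has left \<open>H <#> P\<close>. Earlier exits persist because
  they happen at a prefix.\<close>

lemma positive_word_leaving_all_cosets:
  assumes H: "subgroup H G" and P: "finite P" "P \<subseteq> carrier G"
    and y: "y \<in> carrier G" "y \<notin> H <#> P" and Q: "finite Q" "Q \<subseteq> carrier G"
  obtains as where "as \<in> lists X"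
    "\<And>q. q \<in> Q \<Longrightarrow> \<exists>bs. prefix bs as \<and> q \<otimes> eval_word G (positive_word bs) \<notin> H <#> P"
proof -
  have "\<exists>as\<in>lists X. \<forall>q\<in>Q. \<exists>bs. prefix bs as \<and> q \<otimes> eval_word G (positive_word bs) \<notin> H <#> P"
    using Q
  proof (induction Q rule: finite_induct)
    case empty
    show ?case by (intro bexI[of _ "[]"]) auto
  next
    case (insert q Q)
    then obtain as where as: "as \<in> lists X"
      "\<forall>q\<in>Q. \<exists>bs. prefix bs as \<and> q \<otimes> eval_word G (positive_word bs) \<notin> H <#> P" by auto
    have q: "q \<in> carrier G" using insert by simp
    with as have "q \<otimes> eval_word G (positive_word as) \<in> carrier G" by simp
    then obtain cs where cs: "cs \<in> lists X"
      "q \<otimes> eval_word G (positive_word as) \<otimes> eval_word G (positive_word cs) \<notin> H <#> P"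
      using positive_word_leaving_cosets[OF H P y] by blast
    then have "q \<otimes> eval_word G (positive_word (as @ cs)) \<notin> H <#> P"
      using q as by (simp add: eval_word_append m_assoc)
    then have "\<exists>bs. prefix bs (as @ cs) \<and> r \<otimes> eval_word G (positive_word bs) \<notin> H <#> P"
      if "r \<in> insert q Q" for r
      using as(2) that by (metis insertE prefix_order.refl prefix_prefix)
    with as(1) cs(1) show ?case
      by (intro bexI[of _ "as @ cs"]) auto
  qed
  with that show thesis by blast
qed

text \<open>The finite set \<open>P\<close> of prefix representatives already covers the group:
  otherwise a positive word \<open>w\<close> that leaves \<open>H <#> P\<close> from every element
  of \<open>P\<close> occurs in no normal form of \<open>H\<close>, and its counting quasimorphism
  contradicts density.\<close>

lemma coarsely_dense_imp_finite_index:
  assumes S: "generating_set G S" "finite S" and T: "finite T" "T \<subseteq> carrier G"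
    and H: "H = generate G T"
    and dense: "\<And>y. y \<in> carrier G \<Longrightarrow> \<exists>h\<in>H. biinv_norm G S (inv h \<otimes> y) \<le> N"
  obtains P where "finite P" "P \<subseteq> carrier G" "carrier G = H <#> P"
proof -
  have sub: "subgroup H G" using H generate_is_subgroup[OF T(2)] by simp
  have HG: "h \<in> carrier G" if "h \<in> H" for h using subgroup.mem_carrier[OF sub that] .
  obtain P where P: "finite P" "P \<subseteq> carrier G" "\<one> \<in> P"
    "\<And>h r. h \<in> H \<Longrightarrow> prefix r (word_of h) \<Longrightarrow> eval_word G r \<in> H <#> P"
    using finitely_many_prefix_cosets[OF T H] by blast
  have "y \<in> H <#> P" if y: "y \<in> carrier G" for y
  proof (rule ccontr)
    assume "y \<notin> H <#> P"
    then obtain as where as: "as \<in> lists X"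
      "\<And>q. q \<in> P \<Longrightarrow> \<exists>bs. prefix bs as \<and> q \<otimes> eval_word G (positive_word bs) \<notin> H <#> P"
      using positive_word_leaving_all_cosets[OF sub P(1,2) y _ P(1,2)] by blast
    define w where "w = positive_word as"
    have w: "w \<in> lists letters" "reduced (w @ w)" using as
      by (simp_all add: w_def flip: map_append)
    \<comment> \<open>The identity lies in \<open>H <#> P\<close>, so leaving takes at least one
      letter.\<close>
    have "w \<noteq> []"
    proof
      assume "w = []"
      with as(2)[OF P(3)] have "\<one> \<notin> H <#> P" by (simp add: w_def)
      then show False using P(3) subgroup.one_closed[OF sub] by (force simp: set_mult_iff)
    qed
    have not_sub: "\<not> sublist w (word_of h)" if h: "h \<in> H" for h
    proof
      assume "sublist w (word_of h)"
      then obtain r s where rs: "word_of h = r @ w @ s" by (auto simp: sublist_def)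
      then have r: "r \<in> lists letters" using word_of_in_lists[OF HG[OF h]] by auto
      have "eval_word G r \<in> H <#> P" using P(4)[OF h, of r] rs by auto
      then obtain k q where kq: "k \<in> H" "q \<in> P" "eval_word G r = k \<otimes> q" by (auto simp: set_mult_iff)
      then obtain bs where bs: "prefix bs as" "q \<otimes> eval_word G (positive_word bs) \<notin> H <#> P"
        using as(2) by blast
      have bsl: "bs \<in> lists X" using bs(1) as(1) by (auto simp: prefix_def)
      have "prefix (r @ positive_word bs) (word_of h)"
        using bs(1) rs by (auto simp: w_def prefix_def)
      then have "eval_word G (r @ positive_word bs) \<in> H <#> P" using P(4)[OF h] by blast
      \<comment> \<open>Translating back by \<open>inv k\<close> puts the path from \<open>q\<close>
        inside \<open>H <#> P\<close> at \<open>bs\<close>, where it was chosen outside.\<close>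
      then have "inv k \<otimes> (k \<otimes> q \<otimes> eval_word G (positive_word bs)) \<in> H <#> P"
        using r bsl kq subgroup_set_mult_absorb[OF sub P(2)] subgroup.m_inv_closed[OF sub]
        by (simp add: eval_word_append)
      moreover have "q \<in> carrier G" "k \<in> carrier G" using kq P(2) HG by auto
      ultimately show False using bs(2) bsl by (simp add: m_assoc)
    qed
    have zero: "counting w h = 0" if "h \<in> H" for h
      using that not_sub subgroup.m_inv_closed[OF sub]
      by (simp add: counting_def occurrences_eq_0)
    obtain D where D: "\<bar>counting w (x \<otimes> y) - counting w x - counting w y\<bar> \<le> D"
      if "x \<in> carrier G" "y \<in> carrier G" for x y
      using quasimorphism_counting[of w] by (auto simp: quasimorphism_def)
    obtain A B :: real where AB: "A \<ge> 0"
      "\<And>z. z \<in> carrier G \<Longrightarrow> \<bar>counting w z\<bar> \<le> A * biinv_norm G S z + B"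
      using quasimorphism_le_biinv_norm[OF quasimorphism_counting S] by metis
    \<comment> \<open>\<open>A * N + B\<close> bounds the quasimorphism on elements of norm at most
      \<open>N\<close>, and \<open>D\<close> pays for splitting off a factor in
      \<open>H\<close>.\<close>
    obtain k :: nat where k: "A * N + B + D < k" using reals_Archimedean2 by blast
    define z where "z = eval_word G w [^] k"
    have z: "z \<in> carrier G" using w by (simp add: z_def)
    then obtain h where h: "h \<in> H" "biinv_norm G S (inv h \<otimes> z) \<le> N" using dense by blast
    have "A * biinv_norm G S (inv h \<otimes> z) \<le> A * N"
      using h(2) AB(1) by (intro mult_left_mono) auto
    moreover have "real k \<le> counting w z"
      unfolding z_def using w \<open>w \<noteq> []\<close> by (intro counting_power_ge) auto
    moreover have "h \<otimes> (inv h \<otimes> z) = z" using HG[OF h(1)] z by simp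
    ultimately show False
      using k zero[OF h(1)] D[of h "inv h \<otimes> z"] AB(2)[of "inv h \<otimes> z"] HG[OF h(1)] z by auto
  qed
  moreover have "H <#> P \<subseteq> carrier G" using HG P(2) by (force simp: set_mult_iff)
  ultimately have "carrier G = H <#> P" by blast
  from that[OF P(1,2) this] show thesis .
qed

end

section \<open>Characters of a finite index subgroup\<close>

context group
begin

lemma subgroup_nat_pow_closed:
  assumes "subgroup H G" "x \<in> H"
  shows "x [^] (k::nat) \<in> H"
  by (induction k) (use assms in \<open>simp_all add: subgroup.one_closed subgroup.m_closed\<close>)

text \<open>Take first a power of \<open>g\<close>, then a power of the conjugate of that; the
  product of the exponents serves both.\<close>

lemma common_conjugate_power:
  assumes H: "subgroup H G" and pow: "\<And>g. g \<in> carrier G \<Longrightarrow> \<exists>e::nat. e > 0 \<and> g [^] e \<in> H"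
    and g: "g \<in> carrier G" and q: "q \<in> carrier G"
  obtains e :: nat where "e > 0" "g [^] e \<in> H" "q \<otimes> g [^] e \<otimes> inv q \<in> H"
proof -
  obtain e :: nat where e: "e > 0" "g [^] e \<in> H" using pow g by blast
  obtain d :: nat where d: "d > 0" "(q \<otimes> g [^] e \<otimes> inv q) [^] d \<in> H"
    using pow[of "q \<otimes> g [^] e \<otimes> inv q"] g q by auto
  have "q \<otimes> g [^] (e * d) \<otimes> inv q \<in> H"
    using d(2) g q by (simp add: conj_pow nat_pow_pow)
  moreover have "g [^] (e * d) \<in> H"
    using subgroup_nat_pow_closed[OF H e(2), of d] g by (simp add: nat_pow_pow)
  ultimately show thesis using that[of "e * d"] e d by simp
qed

lemma subgroup_mult_left_iff:
  assumes "subgroup H G" "h \<in> H" "x \<in> carrier G"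
  shows "h \<otimes> x \<in> H \<longleftrightarrow> x \<in> H"
proof
  assume *: "h \<otimes> x \<in> H"
  have h: "h \<in> carrier G" using assms subgroup.mem_carrier by metis
  have "inv h \<otimes> (h \<otimes> x) \<in> H"
    using * assms by (simp add: subgroup.m_closed subgroup.m_inv_closed)
  with h assms(3) show "x \<in> H" by (simp flip: m_assoc)
qed (use assms subgroup.m_closed in metis)

lemma subgroup_mult_right_iff:
  assumes "subgroup H G" "h \<in> H" "x \<in> carrier G"
  shows "x \<otimes> h \<in> H \<longleftrightarrow> x \<in> H"
proof
  assume *: "x \<otimes> h \<in> H"
  have h: "h \<in> carrier G" using assms subgroup.mem_carrier by metis
  have "x \<otimes> h \<otimes> inv h \<in> H"
    using * assms by (simp add: subgroup.m_closed subgroup.m_inv_closed)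
  with h assms(3) show "x \<in> H" by (simp add: m_assoc)
qed (use assms subgroup.m_closed in metis)

end

context based_free_group
begin

text \<open>Weights invariant under \<open>H\<close> are weights on the edges of the coset graph.
  Translation by \<open>h\<close> carries a path from the identity to \<open>x\<close> to a path
  from \<open>h\<close> to \<open>h \<otimes> x\<close> of equal weight; in particular
  \<open>D\<close> is a homomorphism on \<open>H\<close>.\<close>

lemma invariant_potential_exists:
  assumes H: "subgroup H G"
    and \<beta>: "\<And>h x a. h \<in> H \<Longrightarrow> x \<in> carrier G \<Longrightarrow> a \<in> X \<Longrightarrow> \<beta> (h \<otimes> x) a = \<beta> x a"
  obtains D :: "'a \<Rightarrow> int" where "D \<one> = 0"
    and "\<And>x a. x \<in> carrier G \<Longrightarrow> a \<in> X \<Longrightarrow> D (x \<otimes> a) = D x + \<beta> x a"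
    and "\<And>h x. h \<in> H \<Longrightarrow> x \<in> carrier G \<Longrightarrow> D (h \<otimes> x) = D h + D x"
proof -
  obtain D :: "'a \<Rightarrow> int" where D: "D \<one> = 0"
    "\<And>x a. x \<in> carrier G \<Longrightarrow> a \<in> X \<Longrightarrow> D (x \<otimes> a) = D x + \<beta> x a"
    using potential_exists[of \<beta>] by blast
  have D_inv: "D (x \<otimes> inv a) = D x - \<beta> (x \<otimes> inv a) a" if "x \<in> carrier G" "a \<in> X" for x a
    using D(2)[of "x \<otimes> inv a" a] that by simp
  have "D (h \<otimes> x) = D h + D x" if h: "h \<in> H" and x: "x \<in> carrier G" for h x
    using x
  proof (induction x rule: carrier_induct)
    case one
    then show ?case using D(1) h subgroup.mem_carrier[OF H] by simp
  next
    case (basis x a)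
    then show ?case
      using D(2)[of "h \<otimes> x" a] D(2)[of x a] \<beta>[OF h] h subgroup.mem_carrier[OF H]
      by (simp add: m_assoc)
  next
    case (inv_basis x a)
    then show ?case
      using D_inv[of "h \<otimes> x" a] D_inv[of x a] \<beta>[OF h, of "x \<otimes> inv a" a] h subgroup.mem_carrier[OF H]
      by (simp add: m_assoc)
  qed
  with D that show thesis by blast
qed

text \<open>First, weight 1 on the \<open>c\<close>-edge at the coset of the identity shows that all vertices of the
  coset graph lie on one \<open>c\<close>-cycle. Hence \<open>g = a b\<^sup>j \<in> H\<close> for some \<open>j\<close>. Then weight 1 on
  the \<open>a\<close>-edge at the identity coset is crossed \<open>e\<close> times by the loop \<open>g\<^sup>e\<close> started there, but
  never by the same loop started elsewhere.\<close>

lemma conj_invariant_characters_imp_full: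
  assumes H: "subgroup H G" and ab: "a \<in> X" "b \<in> X" "a \<noteq> b"
    and pow: "\<And>g. g \<in> carrier G \<Longrightarrow> \<exists>e::nat. e > 0 \<and> g [^] e \<in> H"
    and conj_inv: "\<And>(\<psi> :: 'a \<Rightarrow> int) h f.
      (\<And>x y. x \<in> H \<Longrightarrow> y \<in> H \<Longrightarrow> \<psi> (x \<otimes> y) = \<psi> x + \<psi> y) \<Longrightarrow>
      h \<in> H \<Longrightarrow> f \<in> carrier G \<Longrightarrow> f \<otimes> h \<otimes> inv f \<in> H \<Longrightarrow> \<psi> (f \<otimes> h \<otimes> inv f) = \<psi> h"
  shows "H = carrier G"
proof -
  have HG: "h \<in> carrier G" if "h \<in> H" for h using subgroup.mem_carrier[OF H that] .
  have potential: "\<exists>D :: 'a \<Rightarrow> int. D \<one> = 0 \<and>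
      (\<forall>x\<in>carrier G. \<forall>y\<in>X. D (x \<otimes> y) = D x + of_bool (y = c \<and> x \<in> H)) \<and>
      (\<forall>h\<in>H. \<forall>x\<in>carrier G. D (h \<otimes> x) = D h + D x) \<and>
      (\<forall>g\<in>H. \<forall>q\<in>carrier G. q \<otimes> g \<otimes> inv q \<in> H \<longrightarrow> D (q \<otimes> g) = D q + D g)" for c
  proof -
    obtain D :: "'a \<Rightarrow> int" where D: "D \<one> = 0"
      "\<And>x y. x \<in> carrier G \<Longrightarrow> y \<in> X \<Longrightarrow> D (x \<otimes> y) = D x + of_bool (y = c \<and> x \<in> H)"
      "\<And>h x. h \<in> H \<Longrightarrow> x \<in> carrier G \<Longrightarrow> D (h \<otimes> x) = D h + D x"
      using invariant_potential_exists[OF H, of "\<lambda>x y. of_bool (y = c \<and> x \<in> H)"]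
        subgroup_mult_left_iff[OF H] by auto
    \<comment> \<open>By conjugation invariance, the loop \<open>g\<close> weighs the same when
      started at \<open>q\<close> as at the identity.\<close>
    have "D (q \<otimes> g) = D q + D g"
      if "g \<in> H" "q \<in> carrier G" "q \<otimes> g \<otimes> inv q \<in> H" for g q
    proof -
      have "D (q \<otimes> g \<otimes> inv q) = D g"
        using that D(3) HG by (intro conj_inv) auto
      moreover have "q \<otimes> g = (q \<otimes> g \<otimes> inv q) \<otimes> q" using that HG by simp
      ultimately show ?thesis using D(3)[OF that(3,2)] by simp
    qed
    with D show ?thesis by blast
  qed
  have reach: "\<exists>i::nat. q \<otimes> c [^] i \<in> H" if q: "q \<in> carrier G" and c: "c \<in> X" for q c
  proof (rule ccontr)
    assume never: "\<nexists>i::nat. q \<otimes> c [^] i \<in> H"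
    obtain D :: "'a \<Rightarrow> int" where D: "D \<one> = 0"
      "\<And>x y. x \<in> carrier G \<Longrightarrow> y \<in> X \<Longrightarrow> D (x \<otimes> y) = D x + of_bool (y = c \<and> x \<in> H)"
      "\<And>g q. g \<in> H \<Longrightarrow> q \<in> carrier G \<Longrightarrow> q \<otimes> g \<otimes> inv q \<in> H \<Longrightarrow> D (q \<otimes> g) = D q + D g"
      using potential[of c] by blast
    \<comment> \<open>Never visiting \<open>H\<close>, the path along \<open>c\<close> from
      \<open>q\<close> misses the weighted edge; the same path from the identity crosses it at its
      first step.\<close>
    have const: "D (q \<otimes> c [^] i) = D q" for i :: nat
    proof (induction i)
      case (Suc i)
      then show ?case
        using never q c D(2)[of "q \<otimes> c [^] i" c] by (auto simp: m_assoc)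
    qed (use q in simp)
    have pos: "D (c [^] Suc i) \<ge> 1" for i
    proof (induction i)
      case 0
      then show ?case using D(1) D(2)[of \<one> c] subgroup.one_closed[OF H] c by simp
    next
      case (Suc i)
      then show ?case using D(2)[of "c [^] Suc i" c] c by simp
    qed
    obtain e :: nat where e: "e > 0" "c [^] e \<in> H" "q \<otimes> c [^] e \<otimes> inv q \<in> H"
      using common_conjugate_power[OF H pow _ q] c basis_closed by blast
    have "D (c [^] e) = 0" using D(3)[OF e(2) q e(3)] const by simp
    with pos[of "e - 1"] e(1) show False by (simp del: nat_pow_Suc)
  qed
  obtain j :: nat where j: "a \<otimes> b [^] j \<in> H" using reach[OF basis_closed[OF ab(1)] ab(2)] by auto
  define g where "g = a \<otimes> b [^] j"
  have g: "g \<in> H" "g \<in> carrier G" using j ab by (simp_all add: g_def)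
  have "q \<in> H" if q: "q \<in> carrier G" for q
  proof (rule ccontr)
    assume "q \<notin> H"
    obtain D :: "'a \<Rightarrow> int" where D: "D \<one> = 0"
      "\<And>x y. x \<in> carrier G \<Longrightarrow> y \<in> X \<Longrightarrow> D (x \<otimes> y) = D x + of_bool (y = a \<and> x \<in> H)"
      "\<And>h x. h \<in> H \<Longrightarrow> x \<in> carrier G \<Longrightarrow> D (h \<otimes> x) = D h + D x"
      "\<And>g q. g \<in> H \<Longrightarrow> q \<in> carrier G \<Longrightarrow> q \<otimes> g \<otimes> inv q \<in> H \<Longrightarrow> D (q \<otimes> g) = D q + D g"
      using potential[of a] by blast
    have b_pow: "D (x \<otimes> b [^] i) = D x" if "x \<in> carrier G" for x and i :: nat
    proof (induction i)
      case (Suc i)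
      then show ?case
        using D(2)[of "x \<otimes> b [^] i" b] ab that by (simp add: m_assoc)
    qed (use that in simp)
    \<comment> \<open>Only the first letter of \<open>g\<close> is an \<open>a\<close>, since
      \<open>b\<close> differs from \<open>a\<close>; so weight is collected exactly when the path
      starts in \<open>H\<close>.\<close>
    have mult_g: "D (x \<otimes> g) = D x + of_bool (x \<in> H)" if "x \<in> carrier G" for x
      using that b_pow[of "x \<otimes> a" j] D(2)[of x a] ab by (simp add: g_def m_assoc)
    have "D (g [^] i) = int i" for i :: nat
    proof (induction i)
      case (Suc i)
      have "g [^] i \<in> H" using subgroup_nat_pow_closed[OF H g(1)] .
      with Suc mult_g[of "g [^] i"] g show ?case by simp
    qed (simp add: D(1))
    moreover have "D (q \<otimes> g [^] i) = D q" for i :: nat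
    proof (induction i)
      case (Suc i)
      have "q \<otimes> g [^] i \<notin> H"
        using \<open>q \<notin> H\<close> subgroup_mult_right_iff[OF H _ q] subgroup_nat_pow_closed[OF H g(1)] by blast
      with Suc mult_g[of "q \<otimes> g [^] i"] q g show ?case by (simp add: m_assoc)
    qed (use q in simp)
    moreover obtain e :: nat where "e > 0" "g [^] e \<in> H" "q \<otimes> g [^] e \<otimes> inv q \<in> H"
      using common_conjugate_power[OF H pow g(2) q] by blast
    ultimately show False using D(4)[of "g [^] e" q] q by simp
  qed
  with HG show ?thesis by blast
qed

end

section \<open>Quasi-isometric homomorphisms\<close>

context group_hom
begin

text \<open>A homomorphism maps conjugates to conjugates, so the finitely many generators bound the
  norm on the image of the conjugation closure; subadditivity does the rest.\<close>

lemma biinv_norm_hom_le: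
  assumes S: "generating_set G S" "finite S" and T: "generating_set H T"
  obtains K :: real where "K > 0"
    "\<And>x. x \<in> carrier G \<Longrightarrow> biinv_norm H T (h x) \<le> K * biinv_norm G S x"
proof -
  define M where "M = (\<Sum>s\<in>S. real (biinv_norm H T (h s)))"
  have "M \<ge> 0" unfolding M_def by (intro sum_nonneg) auto
  have M: "biinv_norm H T (h s) \<le> M" if "s \<in> S" for s
    unfolding M_def using that S(2) by (intro member_le_sum) auto
  have conj: "biinv_norm H T (h s) \<le> M" if s: "s \<in> conj_closure G S" for s
  proof -
    obtain g t where gt: "s = g \<otimes> t \<otimes> inv g" "g \<in> carrier G" "t \<in> carrier G" "t \<in> S \<or> inv t \<in> S"
      using s by (auto simp: conj_closure_def)
    then have "biinv_norm H T (h s) = biinv_norm H T (h t)"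
      using H.biinv_norm_conj[OF T] by simp
    also have "\<dots> \<le> M"
      using M[of t] M[of "inv t"] gt H.biinv_norm_inv[OF T, of "h t"] by auto
    finally show ?thesis by simp
  qed
  \<comment> \<open>\<open>M + 1\<close> in place of \<open>M\<close> makes the constant
    positive.\<close>
  have "biinv_norm H T (h x) \<le> (M + 1) * biinv_norm G S x" if x: "x \<in> carrier G" for x
  proof -
    have "biinv_norm H T (h x) \<le> M * biinv_norm G S x + biinv_norm H T (h \<one>)"
    proof (rule G.subadditive_le_biinv_norm[OF S(1) x])
      show "real (biinv_norm H T (h (x \<otimes> y))) \<le> real (biinv_norm H T (h x)) + real (biinv_norm H T (h y))"
        if "x \<in> carrier G" "y \<in> carrier G" for x y
        using H.biinv_norm_mult[OF T, of "h x" "h y"] that by simp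
    qed (use conj in simp)
    also have "biinv_norm H T (h \<one>) = 0"
      using H.biinv_norm_eq_0[OF T] by simp
    finally show ?thesis by (simp add: algebra_simps)
  qed
  then show thesis using that[of "M + 1"] \<open>M \<ge> 0\<close> by simp
qed

text \<open>The commutator of \<open>f\<close> and \<open>y [^] k\<close> has norm at most twice
  that of \<open>f\<close>, so \<open>qi\<close> bounds its lift
  \<open>v [^] k \<otimes> inv (u [^] k)\<close> independently of \<open>k\<close>. On this lift the
  character takes \<open>k\<close> times the difference of its two values.\<close>

lemma conj_invariant_character:
  fixes \<psi> :: "'c \<Rightarrow> int" and C D :: real
  assumes S: "generating_set G S" "finite S" and T: "generating_set H T"
    and C: "C > 0" and qi: "\<And>x. x \<in> carrier G \<Longrightarrow> biinv_norm G S x \<le> C * (biinv_norm H T (h x) + D)"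
    and \<psi>: "\<And>x y. x \<in> h ` carrier G \<Longrightarrow> y \<in> h ` carrier G \<Longrightarrow> \<psi> (x \<otimes>\<^bsub>H\<^esub> y) = \<psi> x + \<psi> y"
    and y: "y \<in> h ` carrier G" and f: "f \<in> carrier H"
    and conj: "f \<otimes>\<^bsub>H\<^esub> y \<otimes>\<^bsub>H\<^esub> inv\<^bsub>H\<^esub> f \<in> h ` carrier G"
  shows "\<psi> (f \<otimes>\<^bsub>H\<^esub> y \<otimes>\<^bsub>H\<^esub> inv\<^bsub>H\<^esub> f) = \<psi> y"
proof (rule ccontr)
  assume ne: "\<psi> (f \<otimes>\<^bsub>H\<^esub> y \<otimes>\<^bsub>H\<^esub> inv\<^bsub>H\<^esub> f) \<noteq> \<psi> y"
  obtain u v where u: "u \<in> carrier G" "h u = y" and v: "v \<in> carrier G" "h v = f \<otimes>\<^bsub>H\<^esub> y \<otimes>\<^bsub>H\<^esub> inv\<^bsub>H\<^esub> f"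
    using y conj by (metis imageE)
  have yH: "y \<in> carrier H" using u by auto
  \<comment> \<open>Pulled back to \<open>G\<close>, the character is additive everywhere and
    \<open>qi\<close> is available.\<close>
  define \<theta> where "\<theta> x = real_of_int (\<psi> (h x))" for x
  have \<theta>: "\<theta> (x \<otimes> z) = \<theta> x + \<theta> z" if "x \<in> carrier G" "z \<in> carrier G" for x z
    using that \<psi> by (simp add: \<theta>_def)
  have \<theta>_one: "\<theta> \<one> = 0" using \<theta>[of \<one> \<one>] by simp
  have \<theta>_inv: "\<theta> (inv x) = - \<theta> x" if "x \<in> carrier G" for x
    using \<theta>[of x "inv x"] that \<theta>_one by simp
  have \<theta>_pow: "\<theta> (x [^] k) = k * \<theta> x" if "x \<in> carrier G" for x and k :: nat
    by (induction k) (use that \<theta> \<theta>_one in \<open>simp_all add: algebra_simps\<close>)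
  have "quasimorphism G \<theta>" unfolding quasimorphism_def
    by (intro exI[of _ 0]) (simp add: \<theta>)
  then obtain A B :: real where AB: "A \<ge> 0" "\<And>x. x \<in> carrier G \<Longrightarrow> \<bar>\<theta> x\<bar> \<le> A * biinv_norm G S x + B"
    using G.quasimorphism_le_biinv_norm S by metis
  define c where "c = A * (C * (2 * biinv_norm H T f + D)) + B"
  have bound: "k * \<bar>\<theta> v - \<theta> u\<bar> \<le> c" for k :: nat
  proof -
    define z where "z = v [^] k \<otimes> inv (u [^] k)"
    have z: "z \<in> carrier G" using u v by (simp add: z_def)
    have "h z = f \<otimes>\<^bsub>H\<^esub> y [^]\<^bsub>H\<^esub> k \<otimes>\<^bsub>H\<^esub> inv\<^bsub>H\<^esub> f \<otimes>\<^bsub>H\<^esub> inv\<^bsub>H\<^esub> (y [^]\<^bsub>H\<^esub> k)"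
      using u v f yH by (simp add: z_def hom_nat_pow H.conj_pow)
    \<comment> \<open>The commutator is regrouped as \<open>f\<close> times a conjugate of its
      inverse.\<close>
    also have "\<dots> = f \<otimes>\<^bsub>H\<^esub> (y [^]\<^bsub>H\<^esub> k \<otimes>\<^bsub>H\<^esub> inv\<^bsub>H\<^esub> f \<otimes>\<^bsub>H\<^esub> inv\<^bsub>H\<^esub> (y [^]\<^bsub>H\<^esub> k))"
      using f yH by (simp add: H.m_assoc)
    also have "biinv_norm H T \<dots> \<le> biinv_norm H T f + biinv_norm H T f"
      using H.biinv_norm_mult[OF T f] H.biinv_norm_conj[OF T, of "inv\<^bsub>H\<^esub> f" "y [^]\<^bsub>H\<^esub> k"]
        H.biinv_norm_inv[OF T f] f yH
      by (metis H.inv_closed H.m_closed H.nat_pow_closed)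
    finally have "real (biinv_norm H T (h z)) \<le> 2 * biinv_norm H T f" by simp
    then have "biinv_norm G S z \<le> C * (2 * biinv_norm H T f + D)"
      using qi[OF z] C by (smt (verit) mult_left_mono)
    then have "\<bar>\<theta> z\<bar> \<le> c"
      using AB(2)[OF z] mult_left_mono[OF _ AB(1)] unfolding c_def by (smt (verit))
    moreover have "\<theta> z = k * (\<theta> v - \<theta> u)"
      using u v by (simp add: z_def \<theta> \<theta>_inv \<theta>_pow algebra_simps)
    ultimately show ?thesis by (simp add: abs_mult)
  qed
  have "\<bar>\<theta> v - \<theta> u\<bar> > 0" using ne u v by (simp add: \<theta>_def)
  then obtain k :: nat where "c < k * \<bar>\<theta> v - \<theta> u\<bar>" using reals_Archimedean3 by blast
  with bound[of k] show False by simp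
qed

end

text \<open>Both \<open>h\<close> and its inverse are Lipschitz for the norms. The larger constant
  serves both inequalities, without additive error.\<close>

lemma (in group_hom) isomorphism_imp_quasi_isometry:
  assumes S: "generating_set G S" "finite S" and T: "generating_set H T" "finite T"
    and iso: "h \<in> iso G H"
  shows "quasi_isometry (carrier G) (biinv_dist G S) (carrier H) (biinv_dist H T) h"
proof -
  define h' where "h' = inv_into (carrier G) h"
  have bij: "bij_betw h (carrier G) (carrier H)" using iso by (simp add: iso_def)
  have "h' \<in> hom H G" using G.iso_set_sym[OF iso] by (simp add: h'_def iso_def)
  then interpret h': group_hom H G h' by unfold_locales
  obtain K L :: real where K: "K > 0" "\<And>x. x \<in> carrier G \<Longrightarrow> biinv_norm H T (h x) \<le> K * biinv_norm G S x"
    and L: "L > 0" "\<And>y. y \<in> carrier H \<Longrightarrow> biinv_norm G S (h' y) \<le> L * biinv_norm H T y"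
    using biinv_norm_hom_le[OF S T(1)] h'.biinv_norm_hom_le[OF T S(1)] by metis
  have upper: "biinv_norm H T (h x) \<le> max K L * biinv_norm G S x" if "x \<in> carrier G" for x
    using K(2)[OF that] mult_right_mono[of K "max K L" "biinv_norm G S x"] by simp
  have lower: "1 / max K L * biinv_norm G S x \<le> biinv_norm H T (h x)" if x: "x \<in> carrier G" for x
  proof -
    have "h' (h x) = x" using bij x by (simp add: h'_def bij_betw_inv_into_left)
    then have "biinv_norm G S x \<le> max K L * biinv_norm H T (h x)"
      using L(2)[of "h x"] x mult_right_mono[of L "max K L" "biinv_norm H T (h x)"] by simp
    then show ?thesis using K(1) by (simp add: field_simps)
  qed
  have dist: "1 / max K L * biinv_dist G S x y \<le> biinv_dist H T (h x) (h y)"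
    "biinv_dist H T (h x) (h y) \<le> max K L * biinv_dist G S x y"
    if "x \<in> carrier G" "y \<in> carrier G" for x y
    using that lower[of "inv x \<otimes> y"] upper[of "inv x \<otimes> y"] by (simp_all add: biinv_dist_def)
  show ?thesis unfolding quasi_isometry_def
  proof (intro conjI)
    show "\<exists>C D. 0 < C \<and> 0 \<le> D \<and> (\<forall>x\<in>carrier G. \<forall>y\<in>carrier G.
        1 / C * biinv_dist G S x y - D \<le> biinv_dist H T (h x) (h y) \<and>
        biinv_dist H T (h x) (h y) \<le> C * biinv_dist G S x y + D)"
      by (rule exI[of _ "max K L"], rule exI[of _ 0])
        (use K(1) dist in simp)
    show "\<exists>B\<ge>0. \<forall>y\<in>carrier H. \<exists>x\<in>carrier G. biinv_dist H T (h x) y \<le> B"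
    proof (intro exI[of _ 0] conjI ballI)
      fix y assume y: "y \<in> carrier H"
      then obtain x where "x \<in> carrier G" "h x = y" using bij by (metis bij_betw_def imageE)
      with y show "\<exists>x\<in>carrier G. biinv_dist H T (h x) y \<le> 0"
        using H.biinv_norm_eq_0[OF T(1), of "\<one>\<^bsub>H\<^esub>"] by (intro bexI[of _ x]) (simp_all add: biinv_dist_def)
    qed simp
  qed auto
qed

lemma quasi_isometric_hom_imp_iso:
  assumes hom: "group_hom F E \<phi>"
    and F: "based_free_group F Y" and E: "based_free_group E X"
    and ab: "a \<in> X" "b \<in> X" "a \<noteq> b"
    and S: "generating_set F S" "finite S" and T: "generating_set E T" "finite T"
    and qi: "quasi_isometry (carrier F) (biinv_dist F S) (carrier E) (biinv_dist E T) \<phi>"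
  shows "\<phi> \<in> iso F E"
proof -
  interpret F: based_free_group F Y by fact
  interpret E: based_free_group E X by fact
  interpret group_hom F E \<phi> by fact
  obtain C D where C: "C > 0" and CD: "\<And>x y. x \<in> carrier F \<Longrightarrow> y \<in> carrier F \<Longrightarrow>
      1 / C * biinv_dist F S x y - D \<le> biinv_dist E T (\<phi> x) (\<phi> y)"
    using qi unfolding quasi_isometry_def by blast
  obtain B where B: "\<And>y. y \<in> carrier E \<Longrightarrow> \<exists>x\<in>carrier F. biinv_dist E T (\<phi> x) y \<le> B"
    using qi unfolding quasi_isometry_def by blast
  \<comment> \<open>Taking the identity as base point turns distances into norms.\<close>
  have lower: "biinv_norm F S x \<le> C * (biinv_norm E T (\<phi> x) + D)" if "x \<in> carrier F" for x
    using CD[of "\<one>\<^bsub>F\<^esub>" x] that C by (simp add: biinv_dist_def field_simps)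
  \<comment> \<open>All powers of a kernel element map to the identity, so \<open>lower\<close>
    bounds their norms by \<open>C * D\<close>.\<close>
  have "x = \<one>\<^bsub>F\<^esub>" if x: "x \<in> carrier F" "\<phi> x = \<one>\<^bsub>E\<^esub>" for x
  proof (rule ccontr)
    assume "x \<noteq> \<one>\<^bsub>F\<^esub>"
    then obtain k :: nat where k: "biinv_norm F S (x [^]\<^bsub>F\<^esub> k) > nat \<lceil>C * D\<rceil>"
      using F.biinv_norm_powers_unbounded[OF S] x(1) by blast
    have "\<phi> (x [^]\<^bsub>F\<^esub> k) = \<one>\<^bsub>E\<^esub>" using x by (simp add: hom_nat_pow)
    then have "biinv_norm F S (x [^]\<^bsub>F\<^esub> k) \<le> C * D"
      using lower[of "x [^]\<^bsub>F\<^esub> k"] x E.biinv_norm_eq_0[OF T(1), of "\<one>\<^bsub>E\<^esub>"] by simp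
    with k show False by linarith
  qed
  then have inj: "inj_on \<phi> (carrier F)" by (simp add: inj_on_one_iff)
  define I where "I = \<phi> ` carrier F"
  have sub: "subgroup I E" unfolding I_def by (rule img_is_subgroup)
  have ST: "S \<subseteq> carrier F" "generate F S = carrier F" using S(1) by (auto simp: generating_set_def)
  have I: "I = generate E (\<phi> ` S)" using generate_img[OF ST(1)] ST(2) by (simp add: I_def)
  \<comment> \<open>Norms are natural numbers, so the real bound \<open>B\<close> may be rounded
    down.\<close>
  have dense: "\<exists>y\<in>I. biinv_norm E T (inv\<^bsub>E\<^esub> y \<otimes>\<^bsub>E\<^esub> z) \<le> nat \<lfloor>B\<rfloor>" if "z \<in> carrier E" for z
    using B[OF that] le_nat_floor unfolding I_def biinv_dist_def by blast
  have "finite (\<phi> ` S)" "\<phi> ` S \<subseteq> carrier E" using S(2) ST(1) by auto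
  from E.coarsely_dense_imp_finite_index[OF T this I dense]
  obtain P where P: "finite P" "P \<subseteq> carrier E" "carrier E = I <#>\<^bsub>E\<^esub> P" .
  have "I = carrier E"
  proof (rule E.conj_invariant_characters_imp_full[OF sub ab])
    show "\<exists>e::nat. e > 0 \<and> g [^]\<^bsub>E\<^esub> e \<in> I" if "g \<in> carrier E" for g
      using E.finite_index_power[OF sub P that] by blast
    show "\<psi> (f \<otimes>\<^bsub>E\<^esub> y \<otimes>\<^bsub>E\<^esub> inv\<^bsub>E\<^esub> f) = \<psi> y"
      if "\<And>x y. x \<in> I \<Longrightarrow> y \<in> I \<Longrightarrow> \<psi> (x \<otimes>\<^bsub>E\<^esub> y) = \<psi> x + \<psi> y"
        "y \<in> I" "f \<in> carrier E" "f \<otimes>\<^bsub>E\<^esub> y \<otimes>\<^bsub>E\<^esub> inv\<^bsub>E\<^esub> f \<in> I" for \<psi> :: "_ \<Rightarrow> int" and y f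
      by (rule conj_invariant_character[OF S T(1) C lower that[unfolded I_def]])
  qed
  with inj show ?thesis by (simp add: I_def iso_def bij_betw_def homh)
qed

theorem theorem1p1:
  fixes F\<^sub>m :: "('a, 'c) monoid_scheme" and F\<^sub>n :: "('b, 'd) monoid_scheme"
    and m n :: nat and S\<^sub>m :: "'a set" and S\<^sub>n :: "'b set" and \<phi> :: "'a \<Rightarrow> 'b"
  assumes "n \<ge> 2"
    and "free_group_of_rank F\<^sub>m m" and "free_group_of_rank F\<^sub>n n"
    and "finite S\<^sub>m" and "generating_set F\<^sub>m S\<^sub>m"
    and "finite S\<^sub>n" and "generating_set F\<^sub>n S\<^sub>n"
    and "\<phi> \<in> hom F\<^sub>m F\<^sub>n"
  shows "quasi_isometry (carrier F\<^sub>m) (biinv_dist F\<^sub>m S\<^sub>m) (carrier F\<^sub>n) (biinv_dist F\<^sub>n S\<^sub>n) \<phi>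
    \<longleftrightarrow> \<phi> \<in> iso F\<^sub>m F\<^sub>n"
proof -
  obtain Y where Y: "group F\<^sub>m" "free_basis F\<^sub>m Y"
    using assms(2) by (auto simp: free_group_of_rank_def)
  obtain X where X: "group F\<^sub>n" "free_basis F\<^sub>n X" "finite X" "card X = n"
    using assms(3) by (auto simp: free_group_of_rank_def)
  \<comment> \<open>Rank at least two supplies the two distinct letters on which the coset graph
    argument runs.\<close>
  obtain a b where ab: "a \<in> X" "b \<in> X" "a \<noteq> b"
    using assms(1) X(4) by (metis card_2_iff' obtain_subset_with_card_n subsetD)
  have hom: "group_hom F\<^sub>m F\<^sub>n \<phi>"
    using X Y assms(8) by (simp add: group_hom_def group_hom_axioms_def)
  have free: "based_free_group F\<^sub>m Y" "based_free_group F\<^sub>n X"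
    using X Y by (simp_all add: based_free_group_def based_free_group_axioms_def)
  show ?thesis
    using quasi_isometric_hom_imp_iso[OF hom free ab] assms(4-7)
      group_hom.isomorphism_imp_quasi_isometry[OF hom] by blast
qed

end
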